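(* For $k_1,\ldots,k_r\in\mathbb{Z}_{\ge0}$ and all $s\in\mathbb{C}$, \[\eta(-k_1,\ldots,-k_r;s)=\mathfrak{B}^{(s)}_{k_1,\ldots,k_r}.\] Consequently, for every $m\in\mathbb{Z}_{\ge0}$, $B_m^{(-k_1,\ldots,-k_r)}=\mathfrak{B}^{(-m)}_{k_1,\ldots,k_r}$.
   Context: For integers $k_i$, $\mathrm{Li}_{k_1,\ldots,k_r}(z)=\sum_{1\le m_1<\cdots<m_r}z^{m_r}/(m_1^{k_1}\cdots m_r^{k_r})$ for $|z|<1$; for non-positive indices this is a rational function of $z$ with poles only at $z=1$. For $k_i\ge0$, $\eta(-k_1,\ldots,-k_r;s)=\frac{1}{\Gamma(s)}\int_0^\infty t^{s-1}\frac{\mathrm{Li}_{-k_1,\ldots,-k_r}(1-e^t)}{1-e^t}dt$ for $\mathrm{Re}(s)>1-r$, analytically continued to an entire function of $s$. $B_n^{(-k_1,\ldots,-k_r)}$ is defined by $\frac{\mathrm{Li}_{-k_1,\ldots,-k_r}(1-e^{-t})}{1-e^{-t}}=\sum_{n\ge0}B_n^{(-k_1,\ldots,-k_r)}\frac{t^n}{n!}$. For $s\in\mathbb{C}$, the numbers $\mathfrak{B}^{(s)}_{m_1,\ldots,m_r}$ are defined by the expansion near $(x_1,\ldots,x_r)=0$ \[\sum_{a=0}^{r-1}(-1)^a\binom{r-1}{a}\sum_{l_1,\ldots,l_r\ge1}\frac{\prod_{j=1}^r\big(1-e^{-\sum_{\nu=j}^r x_\nu}\big)^{l_j-1}}{(l_1+\cdots+l_r-a)^s}=\sum_{m_1,\ldots,m_r\ge0}\mathfrak{B}^{(s)}_{m_1,\ldots,m_r}\frac{x_1^{m_1}\cdots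 x_r^{m_r}}{m_1!\cdots m_r!}.\] *)

theory Defs
  imports "HOL-Complex_Analysis.Complex_Analysis"
begin

text \<open>Tuples are lists, indexed from 0: the index tuple \<open>(k\<^sub>1, \<dots>, k\<^sub>r)\<close> is the list \<open>ks\<close> with
  \<open>k\<^sub>j = ks ! (j - 1)\<close> and \<open>r = length ks\<close>.\<close>

text \<open>The defining series of the multiple polylogarithm, meaningful for \<open>norm z < 1\<close>.\<close>

definition multi_polylog :: "int list \<Rightarrow> complex \<Rightarrow> complex" where
  "multi_polylog ks z =
     (\<Sum>\<^sub>\<infinity>ms\<in>{ms. length ms = length ks \<and> sorted_wrt (<) ms \<and> (\<forall>m\<in>set ms. 1 \<le> m)}.
        z ^ last ms / (\<Prod>j<length ks. of_nat (ms ! j) powi (ks ! j)))"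

text \<open>For non-positive indices the series is, on the unit disc, a rational function with poles only
  at 1; this is the value at \<open>z \<noteq> 1\<close> of that rational function. It is needed outside the disc, since
  \<open>1 - exp t\<close> ranges over all negative reals for \<open>t > 0\<close>.\<close>

definition multi_polylog_rat :: "int list \<Rightarrow> complex \<Rightarrow> complex" where
  "multi_polylog_rat ks z =
     (THE w. \<exists>(p::complex poly) n.
        (\<forall>u. norm u < 1 \<longrightarrow> multi_polylog ks u = poly p u / (1 - u) ^ n) \<and>
        w = poly p z / (1 - z) ^ n)"

text \<open>\<open>eta ks s\<close> for non-positive entries \<open>ks\<close>: the entire continuation of the Mellin integral.
  \<open>rGamma\<close> is the entire function \<open>1 / Gamma\<close>, zero at the poles of \<open>Gamma\<close>.\<close>

definition eta :: "int list \<Rightarrow> complex \<Rightarrow> complex" where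
  "eta ks =
     (THE f. f holomorphic_on UNIV \<and>
        (\<forall>s. Re s > 1 - real (length ks) \<longrightarrow>
           f s = rGamma s *
             (LBINT t:{0<..}. of_real t powr (s - 1) *
                (multi_polylog_rat ks (of_real (1 - exp t)) / of_real (1 - exp t)))))"

text \<open>The expansion is required on a punctured neighbourhood of 0, where the left-hand side is
  not of the form 0/0.\<close>

definition multi_poly_bernoulli :: "int list \<Rightarrow> nat \<Rightarrow> complex" where
  "multi_poly_bernoulli ks =
     (THE b. \<forall>\<^sub>F t in at 0.
        (\<lambda>n. b n * (t ^ n / fact n)) sums
          (multi_polylog ks (1 - exp (- t)) / (1 - exp (- t))))"

definition frakB_genfun :: "complex \<Rightarrow> complex list \<Rightarrow> complex" where
  "frakB_genfun s xs =
     (let r = length xs in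
      \<Sum>a = 0..r - 1. (- 1) ^ a * of_nat ((r - 1) choose a) *
        (\<Sum>\<^sub>\<infinity>ls\<in>{ls. length ls = r \<and> (\<forall>l\<in>set ls. 1 \<le> l)}.
           (\<Prod>j<r. (1 - exp (- (\<Sum>\<nu> = j..<r. xs ! \<nu>))) ^ (ls ! j - 1)) /
           (of_nat (sum_list ls) - of_nat a) powr s))"

text \<open>\<open>c\<close> is the family of coefficients of the exponential power series of \<open>frakB_genfun s\<close>
  in \<open>r\<close> variables, convergent on some polydisc around 0.\<close>

definition frakB_expansion :: "complex \<Rightarrow> nat \<Rightarrow> (nat list \<Rightarrow> complex) \<Rightarrow> bool" where
  "frakB_expansion s r c \<longleftrightarrow>
     (\<exists>\<epsilon>>0. \<forall>xs. length xs = r \<and> (\<forall>x\<in>set xs. norm x < \<epsilon>) \<longrightarrow>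
        ((\<lambda>ms. c ms * (\<Prod>j<r. xs ! j ^ (ms ! j) / fact (ms ! j)))
           has_sum frakB_genfun s xs) {ms. length ms = r})"

text \<open>Only the values of \<open>c\<close> on lists of length \<open>r\<close> are determined by the expansion, hence the
  description of the single value \<open>c ms\<close> instead of the family.\<close>

definition frakB :: "complex \<Rightarrow> nat list \<Rightarrow> complex" where
  "frakB s ms = (THE b. \<exists>c. frakB_expansion s (length ms) c \<and> b = c ms)"

end

theory Submission
  imports Defs
begin

text \<open>Write \<open>z = 1 - exp t\<close> and \<open>w\<^sub>j = 1 - exp (- x\<^sub>j - \<dots> - x\<^sub>r)\<close>. Summing the polylogarithms against
  \<open>\<Prod>x\<^sub>j ^ k\<^sub>j / k\<^sub>j!\<close> gives formally
  \<open>z\<^sup>r \<Sum>\<^sub>n h\<^sub>n(w\<^sub>1, \<dots>, w\<^sub>r) (1 - z) ^ - (n + r)\<close> with the complete homogeneous symmetric polynomials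
  \<open>h\<^sub>n\<close>. As \<open>w\<^sub>j\<close> has no constant term, only \<open>n \<le> k\<^sub>1 + \<dots> + k\<^sub>r\<close> contribute to a fixed index tuple, and
  \<open>Li(z) / z\<close> is a finite combination of the functions \<open>(1 - exp t) ^ (r - 1) * exp (- (n + r) t)\<close>.
  Expanding the power by the binomial theorem, the Mellin transform turns each \<open>exp (- c t)\<close> into
  \<open>c powr - s\<close>, which is the term of the series defining the right-hand side, while the Taylor
  expansion in \<open>- t\<close> turns it into \<open>c ^ m\<close>.\<close>

section \<open>Coefficients of multiple polylogarithms at non-positive indices\<close>

text \<open>The formal generating function is never summed. The integers
  \<open>polylog_coeff\<close> come from a recursion on the index tuple and are then read in two
  ways: paired with binomial coefficients they give strict nested power sums, hence the coefficients
  of the polylogarithm in \<open>z\<close>; written as alternating sums of weak nested power sums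
  they are the Taylor coefficients that the right-hand side asks for. All quantities then meet in
  one finite expression, \<open>frakB_coeff\<close>. Two obstacles shape the rest. The definition of
  \<open>eta\<close> prescribes its value on \<open>Re s > 1 - r\<close>, but for
  \<open>Re s \<le> 0\<close> the single terms \<open>exp (- c t)\<close> have divergent Mellin
  integrals; there the power \<open>(1 - exp (- t)) ^ (r - 1)\<close> must be kept together and the
  binomial expansion is replaced by integration by parts. Moreover \<open>multi_polylog_rat\<close>,
  \<open>eta\<close>, \<open>multi_poly_bernoulli\<close> and \<open>frakB\<close> are definite
  descriptions, so each closed form also needs an identity theorem: for polynomials, entire
  functions, and power series in one and in several variables.\<close>

definition polylog_coeff_step :: "nat \<Rightarrow> (nat \<Rightarrow> int) \<Rightarrow> nat \<Rightarrow> int" where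
  "polylog_coeff_step r f n = (case n of 0 \<Rightarrow> 0 | Suc n' \<Rightarrow> of_nat (r + n) * f n' - of_nat n * f n)"

text \<open>Argument lists of the functions defined by recursion here are index tuples in reversed order, so
  that the recursion removes the last index: increasing it by one applies \<open>z d/dz\<close>, and appending
  the index 0 multiplies by \<open>z / (1 - z)\<close>. In terms of \<open>y = 1 / (1 - z)\<close>, where \<open>z d/dz\<close> is
  \<open>(y\<^sup>2 - y) d/dy\<close>, the result is \<open>(y - 1)\<^sup>r\<close> times the polynomial in \<open>y\<close> with the
  coefficients \<open>polylog_coeff\<close>.\<close>

primrec polylog_coeff :: "nat list \<Rightarrow> nat \<Rightarrow> int" where
  "polylog_coeff [] = (\<lambda>n. if n = 0 then 1 else 0)"
| "polylog_coeff (k # ks) = (polylog_coeff_step (length ks) ^^ k) (polylog_coeff ks)"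

text \<open>In depth \<open>r\<close>, the operator \<open>(y^2 - y) d/dy\<close> sends
  \<open>(y - 1)^r y^n\<close> to \<open>(y - 1)^r ((r + n) y^(n+1) - n y^n)\<close>. The head of
  the list counts towards the depth, so \<open>r = length ks + 1\<close>, and the coefficient of
  \<open>y^n\<close> receives its predecessor with the factor \<open>length ks + n\<close>.\<close>

lemma polylog_coeff_Cons_Suc: "polylog_coeff (Suc k # ks) = polylog_coeff_step (length ks) (polylog_coeff (k # ks))"
  by simp

lemma polylog_coeff_Cons_0: "polylog_coeff (0 # ks) = polylog_coeff ks"
  by simp

text \<open>Mirrors the two operations that build every polylogarithm from the constant 1: appending
  an index 0, and raising the last index by one.\<close>

lemma nat_list_induct [case_names Nil Zero Suc]:
  assumes "P []" "\<And>ks. P ks \<Longrightarrow> P (0 # ks)" "\<And>k ks. P (k # ks) \<Longrightarrow> P (Suc k # ks)"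
  shows "P ks"
proof (induction ks)
  case (Cons k ks)
  then show ?case by (induction k) (auto intro: assms)
qed (rule assms)

lemma polylog_coeff_eq_0: "sum_list ks < n \<Longrightarrow> polylog_coeff ks n = 0"
proof (induction ks arbitrary: n rule: nat_list_induct)
  case (Suc k ks)
  then show ?case unfolding polylog_coeff_Cons_Suc polylog_coeff_step_def by (auto split: nat.split)
qed auto

text \<open>The coefficient of \<open>z^m\<close> in the polylogarithm, for the reversed tuple. The
  empty tuple is concentrated at \<open>m = 0\<close> and acts as an entry 0 below all others, so
  strictness already forces the summation variables to be positive.\<close>

primrec strict_sum :: "nat list \<Rightarrow> nat \<Rightarrow> nat" where
  "strict_sum [] m = (if m = 0 then 1 else 0)"
| "strict_sum (k # ks) m = m ^ k * (\<Sum>i<m. strict_sum ks i)"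

text \<open>Weakly increasing chains from 0 up to \<open>m\<close>, zeros included. Their
  consecutive differences are arbitrary exponents of total degree \<open>m\<close>, which is why
  these sums lead to complete homogeneous symmetric polynomials.\<close>

primrec weak_sum :: "nat list \<Rightarrow> nat \<Rightarrow> nat" where
  "weak_sum [] m = (if m = 0 then 1 else 0)"
| "weak_sum (k # ks) m = m ^ k * (\<Sum>i\<le>m. weak_sum ks i)"

lemma sum_binomial_diagonal: "(\<Sum>j<i. (j + n) choose (n + q)) = (i + n) choose (Suc (n + q))"
  by (induction i) auto

text \<open>\<open>z^r / (1 - z)^(n + r)\<close> has the coefficient
  \<open>(i + n) choose (n + r - 1)\<close> at \<open>z^(i + 1)\<close>, so this is the closed form
  of the polylogarithm compared coefficient by coefficient. Appending 0 is a hockey-stick sum,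
  raising the last index is multiplication by \<open>i + 1\<close>. The free bound \<open>B\<close>
  lets all tuples of the induction share one range.\<close>

lemma strict_sum_eq:
  assumes "ks = k0 # ks'" "sum_list ks \<le> B"
  shows "int (strict_sum ks (Suc i)) = (\<Sum>n\<le>B. polylog_coeff ks n * int ((i + n) choose (n + length ks')))"
  using assms
proof (induction ks arbitrary: k0 ks' B i rule: nat_list_induct)
  case (Zero ks)
  show ?case
  proof (cases ks)
    case Nil
    with Zero show ?thesis
      by (simp add: if_distrib if_distribR sum.delta sum.delta' cong: if_cong)
  next
    case (Cons l ls)
    have "int (strict_sum (0 # ks) (Suc i)) = (\<Sum>j<Suc i. int (strict_sum ks j))" by simp
    also have "\<dots> = (\<Sum>j<i. int (strict_sum ks (Suc j)))"
      by (subst sum.lessThan_Suc_shift) (simp add: Cons)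
    also have "\<dots> = (\<Sum>j<i. \<Sum>n\<le>B. polylog_coeff ks n * int ((j + n) choose (n + length ls)))"
      using Zero.prems by (intro sum.cong refl Zero.IH[OF Cons]) auto
    also have "\<dots> = (\<Sum>n\<le>B. polylog_coeff ks n * int (\<Sum>j<i. (j + n) choose (n + length ls)))"
      by (subst sum.swap) (simp add: sum_distrib_left)
    finally have "int (strict_sum (0 # ks) (Suc i)) = (\<Sum>n\<le>B. polylog_coeff ks n * int ((i + n) choose Suc (n + length ls)))"
      unfolding sum_binomial_diagonal .
    moreover have "ks' = ks" "length ks = Suc (length ls)" using Zero.prems Cons by auto
    ultimately show ?thesis by (simp del: polylog_coeff.simps strict_sum.simps add: polylog_coeff_Cons_0)
  qed
next
  case (Suc k ks)
  define q where "q = length ks"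
  let ?c = "\<lambda>n. int ((i + n) choose (n + q))"
  let ?A = "polylog_coeff (k # ks)"
  \<comment> \<open>\<open>B\<close> bounds the weight of the larger tuple
    \<open>Suc k # ks\<close>, so this coefficient lies beyond the weight of \<open>k # ks\<close>;
    it is the boundary term of the summation by parts below.\<close>
  have A0: "?A B = 0" using Suc.prems by (intro polylog_coeff_eq_0) auto
  have *: "(\<Sum>n\<le>b. polylog_coeff (Suc k # ks) n * ?c n) =
     (\<Sum>n\<le>b. ?A n * (int (q + n + 1) * ?c (Suc n) - int n * ?c n)) - ?A b * int (q + b + 1) * ?c (Suc b)" for b
    by (induction b) (simp_all add: polylog_coeff_step_def q_def algebra_simps)
  \<comment> \<open>The binomial form of \<open>z d/dz\<close>: absorption gives
    \<open>(q + n + 1) * ?c (Suc n) = (i + n + 1) * ?c n\<close>.\<close>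
  have "int (q + n + 1) * ?c (Suc n) - int n * ?c n = int (Suc i) * ?c n" for n
  proof -
    have "Suc (i + n) * ((i + n) choose (n + q)) = (Suc (i + n) choose Suc (n + q)) * Suc (n + q)"
      by (rule Suc_times_binomial_eq)
    hence "int (Suc (i + n)) * ?c n = int (Suc (i + n) choose Suc (n + q)) * int (Suc (n + q))"
      by (metis of_nat_mult)
    thus ?thesis by (simp add: algebra_simps)
  qed
  hence "(\<Sum>n\<le>B. polylog_coeff (Suc k # ks) n * ?c n) = (\<Sum>n\<le>B. ?A n * (int (Suc i) * ?c n))"
    by (subst *) (simp add: A0 del: polylog_coeff.simps binomial_Suc_Suc of_nat_Suc)
  also have "\<dots> = int (Suc i) * (\<Sum>n\<le>B. ?A n * ?c n)"
    by (simp add: sum_distrib_left mult_ac)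
  also have "(\<Sum>n\<le>B. ?A n * ?c n) = int (strict_sum (k # ks) (Suc i))"
    using Suc.prems by (subst Suc.IH) (auto simp: q_def)
  also have "int (Suc i) * int (strict_sum (k # ks) (Suc i)) = int (strict_sum (Suc k # ks) (Suc i))"
    unfolding strict_sum.simps of_nat_mult of_nat_power power_Suc by (simp only: mult.assoc)
  finally show ?case using Suc.prems by (simp del: polylog_coeff.simps strict_sum.simps add: q_def)
qed auto

text \<open>Summation by parts with signs. It is applied to binomial coefficients \<open>c\<close>,
  for which \<open>c N + c (Suc N)\<close> is a Pascal sum, and to the partial sums \<open>U\<close>
  that an appended index 0 creates.\<close>

lemma abel_alternating:
  fixes c U t :: "nat \<Rightarrow> 'a::comm_ring_1"
  assumes "\<And>N. U N = (\<Sum>i\<le>N. t i)"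
  shows "(\<Sum>N\<le>m. (-1) ^ N * (c N + c (Suc N)) * U N) = (\<Sum>N\<le>m. (-1) ^ N * c N * t N) + (-1) ^ m * c (Suc m) * U m"
proof (induction m)
  case (Suc m)
  have "U (Suc m) = U m + t (Suc m)" by (simp add: assms)
  then show ?case using Suc by (simp add: algebra_simps)
qed (simp add: assms algebra_simps)

text \<open>Dual to \<open>strict_sum_eq\<close>: by \<open>complete_symm_one_minus\<close>, which has the same coefficients, it
  exhibits the \<open>n\<close>-th coefficients as the exponential Taylor coefficients of the \<open>n\<close>-th complete
  homogeneous symmetric polynomial in the \<open>1 - exp (- x\<^sub>j - \<dots> - x\<^sub>r)\<close>.\<close>

lemma polylog_coeff_eq_weak_sum:
  assumes "ks = k0 # ks'"
  shows "polylog_coeff ks n = (-1) ^ sum_list ks * (\<Sum>N\<le>n. (-1) ^ N * int ((n + length ks') choose (N + length ks')) * int (weak_sum ks N))"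
  using assms
proof (induction ks arbitrary: k0 ks' n rule: nat_list_induct)
  case (Zero ks)
  show ?case
  proof (cases ks)
    case Nil
    have "(\<Sum>N\<le>n. (-1) ^ N * int (n choose N)) = (if n = 0 then 1 else 0)"
      by (cases "n = 0") (auto simp: choose_alternating_sum)
    then show ?thesis using Zero.prems Nil by (simp add: if_distrib sum.delta sum.delta' cong: if_cong)
  next
    case (Cons l ls)
    let ?q = "length ls"
    have "(-1) ^ sum_list ks * (\<Sum>N\<le>n. (-1) ^ N * int ((n + Suc ?q) choose (N + Suc ?q)) * int (weak_sum (0 # ks) N))
       = (-1) ^ sum_list ks * (\<Sum>N\<le>n. (-1) ^ N * (int ((n + ?q) choose (N + ?q)) + int ((n + ?q) choose (Suc N + ?q))) * int (weak_sum (0 # ks) N))"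
      by simp
    also have "(\<Sum>N\<le>n. (-1) ^ N * (int ((n + ?q) choose (N + ?q)) + int ((n + ?q) choose (Suc N + ?q))) * int (weak_sum (0 # ks) N))
       = (\<Sum>N\<le>n. (-1) ^ N * int ((n + ?q) choose (N + ?q)) * int (weak_sum ks N))"
      by (subst abel_alternating[where t = "\<lambda>N. int (weak_sum ks N)"]) (simp_all add: binomial_eq_0)
    also have "(-1) ^ sum_list ks * \<dots> = polylog_coeff ks n" by (rule Zero.IH[OF Cons, symmetric])
    finally have "polylog_coeff (0 # ks) n = (-1) ^ sum_list ks * (\<Sum>N\<le>n. (-1) ^ N * int ((n + Suc ?q) choose (N + Suc ?q)) * int (weak_sum (0 # ks) N))"
      by (simp only: polylog_coeff_Cons_0)
    moreover have "ks' = ks" "length ks = Suc ?q" using Zero.prems Cons by auto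
    ultimately show ?thesis by (simp del: polylog_coeff.simps weak_sum.simps binomial_Suc_Suc)
  qed
next
  case (Suc k ks)
  define q where "q = length ks"
  have IH: "polylog_coeff (k # ks) n = (-1) ^ sum_list (k # ks) * (\<Sum>N\<le>n. (-1) ^ N * int ((n + q) choose (N + q)) * int (weak_sum (k # ks) N))" for n
    unfolding q_def by (rule Suc.IH) simp
  let ?t = "\<lambda>N. int (weak_sum (k # ks) N)"
  have "polylog_coeff (Suc k # ks) n = (-1) ^ sum_list (k # ks) * (\<Sum>N\<le>n. (-1) ^ N * (- int N * int ((n + q) choose (N + q))) * ?t N)"
  proof (cases n)
    case 0
    then show ?thesis by (simp add: polylog_coeff_step_def)
  next
    case (Suc n')
    have "polylog_coeff (Suc k # ks) n = int (q + n) * polylog_coeff (k # ks) n' - int n * polylog_coeff (k # ks) n"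
      unfolding polylog_coeff_Cons_Suc by (simp add: polylog_coeff_step_def Suc q_def del: of_nat_Suc)
    also have "polylog_coeff (k # ks) n' = (-1) ^ sum_list (k # ks) * (\<Sum>N\<le>n. (-1) ^ N * int ((n' + q) choose (N + q)) * ?t N)"
      unfolding IH by (simp add: Suc binomial_eq_0)
    also have "int (q + n) * \<dots> - int n * polylog_coeff (k # ks) n = (-1) ^ sum_list (k # ks) *
       (\<Sum>N\<le>n. (-1) ^ N * (int (q + n) * int ((n' + q) choose (N + q)) - int n * int ((n + q) choose (N + q))) * ?t N)"
      unfolding IH by (simp only: ring_distribs sum_distrib_left mult_ac sum_subtractf)
    also have "(\<Sum>N\<le>n. (-1) ^ N * (int (q + n) * int ((n' + q) choose (N + q)) - int n * int ((n + q) choose (N + q))) * ?t N)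
      = (\<Sum>N\<le>n. (-1) ^ N * (- int N * int ((n + q) choose (N + q))) * ?t N)"
    \<comment> \<open>Absorption gives \<open>(q + n) * ((n' + q) choose (N + q)) = (n - N) * ((n +
      q) choose (N + q))\<close>, so the two-term recursion collapses to the factor
      \<open>- N\<close>: its sign joins \<open>(-1) ^ sum_list\<close>, its \<open>N\<close> raises
      the power in \<open>weak_sum\<close>.\<close>
    proof (intro sum.cong refl arg_cong2[where f = times])
      fix N assume "N \<in> {..n}"
      hence "N \<le> n" by simp
      have "((n + q) - (N + q)) * ((n + q) choose (N + q)) = (n + q) * ((n + q - 1) choose (N + q))"
        by (rule binomial_absorb_comp)
      hence "int (n - N) * int ((n + q) choose (N + q)) = int (n + q) * int ((n' + q) choose (N + q))"
        using Suc by (metis add_Suc diff_Suc_1 diff_cancel2 of_nat_mult)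
      with \<open>N \<le> n\<close> show "int (q + n) * int ((n' + q) choose (N + q)) - int n * int ((n + q) choose (N + q)) = - int N * int ((n + q) choose (N + q))"
        by (simp add: of_nat_diff algebra_simps)
    qed
    finally show ?thesis .
  qed
  also have "\<dots> = (-1) ^ sum_list (Suc k # ks) * (\<Sum>N\<le>n. (-1) ^ N * int ((n + q) choose (N + q)) * int (weak_sum (Suc k # ks) N))"
    by (simp add: sum_negf mult_ac flip: sum_distrib_left)
  finally show ?case using Suc.prems by (simp add: q_def)
qed auto

section \<open>Complete homogeneous symmetric polynomials\<close>

primrec complete_symm :: "'a::comm_ring_1 list \<Rightarrow> nat \<Rightarrow> 'a" where
  "complete_symm [] n = (if n = 0 then 1 else 0)"
| "complete_symm (w # ws) n = (\<Sum>i\<le>n. w ^ i * complete_symm ws (n - i))"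

lemma complete_symm_0: "complete_symm ws 0 = 1"
  by (induction ws) auto

lemma complete_symm_Suc: "complete_symm (w # ws) (Suc n) = complete_symm ws (Suc n) + w * complete_symm (w # ws) n"
  by (simp add: sum.atMost_Suc_shift sum_distrib_left mult_ac del: sum.atMost_Suc)

lemma complete_symm_snoc: "complete_symm (ws @ [w]) n = (\<Sum>i\<le>n. complete_symm ws i * w ^ (n - i))"
proof (induction ws arbitrary: n)
  case Nil
  show ?case by (simp add: if_distrib if_distribR sum.delta sum.delta' cong: if_cong) 
next
  case (Cons v vs)
  note IH = this
  show ?case
  proof (induction n)
    case (Suc n)
    have "complete_symm ((v # vs) @ [w]) (Suc n) = complete_symm (vs @ [w]) (Suc n) + v * complete_symm ((v # vs) @ [w]) n"
      using complete_symm_Suc[of v "vs @ [w]" n] by simp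
    also have "\<dots> = (\<Sum>i\<le>Suc n. complete_symm vs i * w ^ (Suc n - i)) + (\<Sum>i\<le>n. v * complete_symm (v # vs) i * w ^ (n - i))"
      unfolding Suc IH by (simp add: sum_distrib_left mult_ac)
    also have "\<dots> = w ^ Suc n + (\<Sum>i\<le>n. (complete_symm vs (Suc i) + v * complete_symm (v # vs) i) * w ^ (n - i))"
      by (subst sum.atMost_Suc_shift) (simp add: complete_symm_0 ring_distribs sum.distrib del: complete_symm.simps)
    also have "\<dots> = (\<Sum>i\<le>Suc n. complete_symm (v # vs) i * w ^ (Suc n - i))"
      by (subst sum.atMost_Suc_shift) (simp add: complete_symm_0 complete_symm_Suc del: complete_symm.simps)
    finally show ?case .
  qed (simp add: complete_symm_0 del: complete_symm.simps)
qed

lemma complete_symm_scale: "complete_symm (map ((*) c) ws) n = c ^ n * complete_symm ws n"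
proof (induction ws arbitrary: n)
  case (Cons w ws)
  have "complete_symm (map ((*) c) (w # ws)) n = (\<Sum>i\<le>n. (c ^ i * c ^ (n - i)) * (w ^ i * complete_symm ws (n - i)))"
    by (simp add: Cons power_mult_distrib mult_ac)
  also have "\<dots> = (\<Sum>i\<le>n. c ^ n * (w ^ i * complete_symm ws (n - i)))"
    by (intro sum.cong refl) (simp flip: power_add)
  finally show ?case by (simp add: sum_distrib_left)
qed auto

text \<open>Generating functions explain the coefficients: for \<open>r\<close> variables,
  \<open>\<Prod> 1 / (1 - (1 - v_j) t) = (1 - t)^(-r) \<Prod> 1 / (1 + v_j t / (1 - t))\<close>, and
  \<open>t^N (1 - t)^(-N - r)\<close> has the coefficient
  \<open>(n + r - 1) choose (N + r - 1)\<close> at \<open>t^n\<close>. The proof replaces the series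
  by an inner induction on \<open>n\<close>.\<close>

lemma complete_symm_one_minus:
  fixes vs :: "'a::comm_ring_1 list"
  assumes "vs = v # vs'"
  shows "complete_symm (map (\<lambda>v. 1 - v) vs) n =
    (\<Sum>N\<le>n. (-1) ^ N * of_nat ((n + length vs') choose (N + length vs')) * complete_symm vs N)"
  using assms
proof (induction vs arbitrary: n v vs')
  case (Cons u us)
  show ?case
  proof (cases us)
    case Nil
    have "(1 - u) ^ n = (\<Sum>N\<le>n. of_nat (n choose N) * (- u) ^ N * 1 ^ (n - N))"
      by (subst binomial_ring [symmetric]) simp
    then show ?thesis using Nil Cons.prems
      by (simp add: if_distrib if_distribR sum.delta sum.delta' power_minus[of u] mult_ac cong: if_cong)
  next
    case us: (Cons u' us')
    define q where "q = length us'"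
    let ?g = "\<lambda>n. \<Sum>N\<le>n. (-1) ^ N * of_nat ((n + Suc q) choose (N + Suc q)) * complete_symm (u # us) N"
    have IH: "complete_symm (map (\<lambda>v. 1 - v) us) n = (\<Sum>N\<le>n. (-1) ^ N * of_nat ((n + q) choose (N + q)) * complete_symm us N)" for n
      unfolding q_def by (rule Cons.IH[OF us])
    have "complete_symm (map (\<lambda>v. 1 - v) (u # us)) n = ?g n" for n
    proof (induction n)
      case (Suc n)
      let ?c = "\<lambda>M. of_nat ((n + Suc q) choose (M + q)) :: 'a"
      have "complete_symm (map (\<lambda>v. 1 - v) (u # us)) (Suc n) = complete_symm (map (\<lambda>v. 1 - v) us) (Suc n) + (1 - u) * ?g n"
        unfolding Suc[symmetric] using complete_symm_Suc[of "1 - u" "map (\<lambda>v. 1 - v) us" n] by simp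
      also have "\<dots> = (\<Sum>M\<le>Suc n. (-1) ^ M * ?c M * complete_symm us M) + ?g n
          - (\<Sum>N\<le>n. (-1) ^ N * ?c (Suc N) * (u * complete_symm (u # us) N))"
        unfolding IH by (simp add: algebra_simps sum_distrib_left sum_subtractf del: complete_symm.simps sum.atMost_Suc binomial_Suc_Suc)
      \<comment> \<open>\<open>complete_symm_Suc\<close> read backwards removes the factor
        \<open>u\<close>; the terms in \<open>us\<close> alone then cancel and Pascal's rule merges
        the two binomial coefficients.\<close>
      also have "(\<Sum>N\<le>n. (-1) ^ N * ?c (Suc N) * (u * complete_symm (u # us) N)) =
          - (\<Sum>M\<le>Suc n. (-1) ^ M * ?c M * (complete_symm (u # us) M - complete_symm us M))"
        by (subst sum.atMost_Suc_shift) (simp add: complete_symm_0 complete_symm_Suc sum_negf del: complete_symm.simps)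
      also have "?g n = (\<Sum>M\<le>Suc n. (-1) ^ M * ?c (Suc M) * complete_symm (u # us) M)"
        by (simp add: binomial_eq_0)
      also have "(\<Sum>M\<le>Suc n. (-1) ^ M * ?c M * complete_symm us M)
          + (\<Sum>M\<le>Suc n. (-1) ^ M * ?c (Suc M) * complete_symm (u # us) M)
          - (- (\<Sum>M\<le>Suc n. (-1) ^ M * ?c M * (complete_symm (u # us) M - complete_symm us M)))
          = (\<Sum>M\<le>Suc n. (-1) ^ M * (?c M + ?c (Suc M)) * complete_symm (u # us) M)"
        by (simp only: ring_distribs sum.distrib sum_subtractf right_diff_distrib minus_minus) simp
      also have "\<dots> = ?g (Suc n)" by simp
      finally show ?case .
    qed (simp add: complete_symm_0 del: complete_symm.simps)
    moreover have "vs' = us" "length us = Suc q" using Cons.prems us by (auto simp: q_def)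
    ultimately show ?thesis by (simp del: complete_symm.simps binomial_Suc_Suc list.map)
  qed
qed auto

lemma norm_complete_symm_le:
  fixes ws :: "'a::{real_normed_field} list"
  assumes "\<And>w. w \<in> set ws \<Longrightarrow> norm w \<le> B" and B: "0 \<le> B"
  shows "norm (complete_symm ws n) \<le> real (Suc n) ^ length ws * B ^ n"
  using assms(1)
proof (induction ws arbitrary: n)
  case (Cons w ws)
  have "norm (complete_symm (w # ws) n) \<le> (\<Sum>i\<le>n. norm (w ^ i * complete_symm ws (n - i)))"
    by (simp add: norm_sum)
  also have "\<dots> \<le> (\<Sum>i\<le>n. B ^ i * (real (Suc n) ^ length ws * B ^ (n - i)))"
  proof (intro sum_mono)
    fix i assume i: "i \<in> {..n}"
    have "norm (complete_symm ws (n - i)) \<le> real (Suc (n - i)) ^ length ws * B ^ (n - i)"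
      using Cons by auto
    also have "\<dots> \<le> real (Suc n) ^ length ws * B ^ (n - i)"
      using B by (intro mult_right_mono power_mono zero_le_power) auto
    finally show "norm (w ^ i * complete_symm ws (n - i)) \<le> B ^ i * (real (Suc n) ^ length ws * B ^ (n - i))"
      unfolding norm_mult norm_power using Cons.prems B by (intro mult_mono power_mono zero_le_power) auto
  qed
  also have "\<dots> = (\<Sum>i\<le>n. real (Suc n) ^ length ws * B ^ n)"
    by (intro sum.cong refl) (simp add: mult_ac flip: power_add)
  finally show ?case by (simp add: algebra_simps)
qed (use B in auto)

section \<open>A family of Mellin transforms\<close>

definition mellin_kernel :: "nat \<Rightarrow> complex \<Rightarrow> real \<Rightarrow> real \<Rightarrow> complex" where
  "mellin_kernel q s c t = of_real t powr (s - 1) * of_real (exp (- (c * t)) * (1 - exp (- t)) ^ q)"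

text \<open>Up to the sign \<open>(-1) ^ q\<close>, the \<open>q\<close>-th forward difference of
  \<open>c powr (- s)\<close> in \<open>c\<close>. As a finite sum it makes sense for every
  \<open>s\<close>, unlike the integral it evaluates.\<close>

definition mellin_value :: "nat \<Rightarrow> complex \<Rightarrow> real \<Rightarrow> complex" where
  "mellin_value q s c = (\<Sum>a\<le>q. (-1) ^ a * of_nat (q choose a) * of_real (c + real a) powr (- s))"

lemma one_minus_exp_bounds:
  fixes t :: real
  assumes "0 < t"
  shows "0 \<le> 1 - exp (- t)" "1 - exp (- t) \<le> t"
  using assms exp_ge_add_one_self[of "- t"] by auto

lemma mellin_factor_bound:
  assumes "0 < t"
  shows "norm (of_real (exp (- (c * t)) * (1 - exp (- t)) ^ q) :: complex) \<le> t ^ q * exp (- (c * t))"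
proof -
  have "(1 - exp (- t)) ^ q \<le> t ^ q" "0 \<le> (1 - exp (- t)) ^ q"
    using one_minus_exp_bounds[OF assms] by (auto intro: power_mono)
  hence "\<bar>exp (- (c * t)) * (1 - exp (- t)) ^ q\<bar> \<le> exp (- (c * t)) * t ^ q"
    by (simp add: abs_mult)
  thus ?thesis unfolding norm_of_real by (simp only: mult.commute)
qed

lemma powr_times_power: "0 < t \<Longrightarrow> t powr a * t ^ q = t powr (a + real q)" for t :: real
  by (simp add: powr_add powr_realpow)

lemma set_integrable_gamma_kernel:
  assumes "0 < Re z" "0 < c"
  shows "set_integrable lborel {0<..} (\<lambda>t. complex_of_real t powr (z - 1) / of_real (exp (c * t)))"
proof -
  have "integrable lebesgue (\<lambda>t. indicator {0<..} t *\<^sub>R (complex_of_real t powr (z - 1) / of_real (exp (c * t))))"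
    using absolutely_integrable_Gamma_integral[OF assms] unfolding set_integrable_def .
  thus ?thesis unfolding set_integrable_def
    by (subst (asm) integrable_completion) simp_all
qed

text \<open>The bound \<open>1 - exp (- t) \<le> t\<close> gains \<open>q\<close> powers of
  \<open>t\<close> at 0, so the Gamma integrand at \<open>s + q\<close> dominates.\<close>

lemma set_integrable_mellin_kernel:
  assumes "- real q < Re s" "0 < c"
  shows "set_integrable lborel {0<..} (mellin_kernel q s c)"
proof (rule set_integrable_bound[OF set_integrable_gamma_kernel[of "s + of_nat q" c]])
  show "set_borel_measurable lborel {0<..} (mellin_kernel q s c)"
    unfolding set_borel_measurable_def mellin_kernel_def by measurable
  show "AE t in lborel. t \<in> {0<..} \<longrightarrow>
      norm (mellin_kernel q s c t) \<le> norm (complex_of_real t powr (s + of_nat q - 1) / of_real (exp (c * t)))"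
  proof (rule AE_I2, safe)
    fix t :: real assume t: "0 < t"
    have "norm (mellin_kernel q s c t) \<le> t powr (Re s - 1) * (t ^ q * exp (- (c * t)))"
      unfolding mellin_kernel_def norm_mult[of "_ powr _"]
      using t by (intro mult_mono mellin_factor_bound) (auto simp: norm_powr_real_powr)
    also have "\<dots> = t powr (Re s - 1 + real q) * exp (- (c * t))"
      using powr_times_power[OF t, of "Re s - 1" q] by (simp add: mult.assoc[symmetric])
    also have "\<dots> = norm (complex_of_real t powr (s + of_nat q - 1) / of_real (exp (c * t)))"
      using t by (simp add: norm_divide norm_powr_real_powr exp_minus field_simps)
    finally show "norm (mellin_kernel q s c t) \<le> norm (complex_of_real t powr (s + of_nat q - 1) / of_real (exp (c * t)))" .
  qed
qed (use assms in auto)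

lemma LBINT_gamma_kernel:
  assumes "0 < Re s" "0 < c"
  shows "(LBINT t:{0<..}. mellin_kernel 0 s c t) = Gamma s * of_real c powr (- s)"
proof -
  have si: "set_integrable lborel {0<..} (\<lambda>t. complex_of_real t powr (s - 1) / of_real (exp t))"
    using set_integrable_gamma_kernel[OF assms(1), of 1] by simp
  have "((\<lambda>t. complex_of_real t powr (s - 1) / of_real (exp t)) has_integral
       (LBINT t:{0<..}. complex_of_real t powr (s - 1) / of_real (exp t))) {0<..}"
    using has_integral_integral[THEN iffD1, OF set_borel_integral_eq_integral(1)[OF si]]
    unfolding set_borel_integral_eq_integral(2)[OF si] .
  hence G: "(LBINT t:{0<..}. complex_of_real t powr (s - 1) / of_real (exp t)) = Gamma s"
    using Gamma_integral_complex'[OF assms(1)] by (rule has_integral_unique)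
  have "Gamma s = \<bar>c\<bar> *\<^sub>R (\<integral>t. indicator {0<..} (0 + c * t) *\<^sub>R (complex_of_real (0 + c * t) powr (s - 1) / of_real (exp (0 + c * t))) \<partial>lborel)"
    unfolding G[symmetric] set_lebesgue_integral_def
    by (rule lborel_integral_real_affine) (use assms in auto)
  also have "\<dots> = (\<integral>t. c *\<^sub>R (indicator {0<..} (0 + c * t) *\<^sub>R (complex_of_real (0 + c * t) powr (s - 1) / of_real (exp (0 + c * t)))) \<partial>lborel)"
    using assms by (simp only: integral_scaleR_right abs_of_pos)
  also have "\<dots> = (\<integral>t. of_real c powr s * (indicator {0<..} t *\<^sub>R mellin_kernel 0 s c t) \<partial>lborel)"
  proof (rule Bochner_Integration.integral_cong)
    fix t :: real
    have "c *\<^sub>R (complex_of_real (c * t) powr (s - 1) / of_real (exp (c * t))) = of_real c powr s * mellin_kernel 0 s c t" if "0 < t"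
    proof -
      have "complex_of_real (c * t) powr (s - 1) = of_real c powr (s - 1) * of_real t powr (s - 1)"
        using that assms by (simp add: powr_times_real)
      moreover have "of_real c * complex_of_real c powr (s - 1) = of_real c powr s"
        using assms by (simp add: powr_diff)
      ultimately show ?thesis
        by (simp add: mellin_kernel_def scaleR_conv_of_real exp_minus divide_inverse mult_ac flip: of_real_exp)
    qed
    moreover have "0 < c * t \<longleftrightarrow> 0 < t" using assms by (simp add: zero_less_mult_iff)
    ultimately show "c *\<^sub>R (indicator {0<..} (0 + c * t) *\<^sub>R (complex_of_real (0 + c * t) powr (s - 1) / of_real (exp (0 + c * t))))
        = of_real c powr s * (indicator {0<..} t *\<^sub>R mellin_kernel 0 s c t)"
      by (auto simp: indicator_def)
  qed simp
  also have "\<dots> = of_real c powr s * (LBINT t:{0<..}. mellin_kernel 0 s c t)"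
    unfolding set_lebesgue_integral_def mult_scaleR_right[symmetric] by (rule integral_mult_right_zero)
  finally show ?thesis using assms by (simp add: powr_minus field_simps)
qed

lemma mellin_value_Suc: "mellin_value (Suc q) s c = mellin_value q s c - mellin_value q s (c + 1)"
proof -
  let ?f = "\<lambda>a. (-1) ^ a * of_real (c + real a) powr (- s) :: complex"
  have "mellin_value (Suc q) s c = (\<Sum>a\<le>Suc q. of_nat (Suc q choose a) * ?f a)"
    by (simp add: mellin_value_def mult_ac)
  also have "\<dots> = ?f 0 + (\<Sum>a\<le>q. of_nat (q choose Suc a) * ?f (Suc a)) + (\<Sum>a\<le>q. of_nat (q choose a) * ?f (Suc a))"
    by (subst sum.atMost_Suc_shift) (simp add: algebra_simps sum.distrib sum_subtractf sum_negf)
  also have "?f 0 + (\<Sum>a\<le>q. of_nat (q choose Suc a) * ?f (Suc a)) = (\<Sum>a\<le>Suc q. of_nat (q choose a) * ?f a)"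
    by (subst sum.atMost_Suc_shift) simp
  also have "\<dots> = mellin_value q s c"
    by (simp add: mellin_value_def mult_ac)
  also have "(\<Sum>a\<le>q. of_nat (q choose a) * ?f (Suc a)) = - mellin_value q s (c + 1)"
    by (simp add: mellin_value_def sum_negf mult_ac add_ac)
  finally show ?thesis by simp
qed

text \<open>The counterpart, for the values, of integration by parts for the integrals; the
  induction below compares the two recurrences. It comes from splitting off one factor
  \<open>c + a\<close> and absorbing \<open>a\<close> into the binomial coefficient.\<close>

lemma mellin_value_shift:
  assumes "0 < c"
  shows "mellin_value (Suc q) s c = of_real c * mellin_value (Suc q) (s + 1) c - of_nat (Suc q) * mellin_value q (s + 1) (c + 1)"
proof -
  let ?p = "\<lambda>a. of_real (c + real a) powr (- (s + 1)) :: complex"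
  have p: "of_real (c + real a) powr (- s) = of_real c * ?p a + of_nat a * ?p a" for a
  proof -
    have "of_real (c + real a) powr (- s) = (of_real (c + real a) * ?p a :: complex)"
      using assms powr_add[of "complex_of_real (c + real a)" 1 "- (s + 1)"] by simp
    thus ?thesis by (simp add: ring_distribs)
  qed
  have "mellin_value (Suc q) s c = of_real c * mellin_value (Suc q) (s + 1) c +
      (\<Sum>a\<le>Suc q. (-1) ^ a * of_nat (Suc q choose a) * (of_nat a * ?p a))"
    unfolding mellin_value_def p by (simp only: ring_distribs sum.distrib sum_distrib_left mult_ac)
  also have "(\<Sum>a\<le>Suc q. (-1) ^ a * of_nat (Suc q choose a) * (of_nat a * ?p a))
      = (\<Sum>a\<le>q. - ((-1) ^ a * (of_nat (Suc a * (Suc q choose Suc a))) * ?p (Suc a)))"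
    by (subst sum.atMost_Suc_shift) (simp only: of_nat_mult mult_ac power_Suc mult_minus_left mult_minus_right mult_1_left of_nat_0 mult_zero_left mult_zero_right add_0_left)
  also have "\<dots> = - (of_nat (Suc q) * mellin_value q (s + 1) (c + 1))"
    unfolding Suc_times_binomial mellin_value_def sum_negf sum_distrib_left of_nat_mult
    by (simp add: mult_ac add_ac del: of_nat_Suc) (simp add: mult_ac add_ac)
  finally show ?thesis by simp
qed

lemma mellin_kernel_Suc:
  "mellin_kernel (Suc q) s c t = mellin_kernel q s c t - mellin_kernel q s (c + 1) t"
proof -
  have "exp (- ((c + 1) * t)) = exp (- (c * t)) * exp (- t)"
    by (simp add: algebra_simps flip: exp_add)
  thus ?thesis by (simp add: mellin_kernel_def algebra_simps)
qed

text \<open>On both sides a step in \<open>q\<close> is the difference between the parameters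
  \<open>c\<close> and \<open>c + 1\<close>; for \<open>Re s > 0\<close> each piece is integrable,
  so the integral may be split.\<close>

lemma LBINT_mellin_kernel_right:
  assumes "0 < Re s" "0 < c"
  shows "(LBINT t:{0<..}. mellin_kernel q s c t) = Gamma s * mellin_value q s c"
  using assms(2)
proof (induction q arbitrary: c)
  case 0
  then show ?case using LBINT_gamma_kernel[OF assms(1)] by (simp add: mellin_value_def)
next
  case (Suc q)
  have "(LBINT t:{0<..}. mellin_kernel (Suc q) s c t) =
      (LBINT t:{0<..}. mellin_kernel q s c t) - (LBINT t:{0<..}. mellin_kernel q s (c + 1) t)"
    unfolding mellin_kernel_Suc using Suc.prems assms(1)
    by (intro set_integral_diff set_integrable_mellin_kernel) auto
  then show ?case using Suc by (simp add: mellin_value_Suc algebra_simps)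
qed

lemma tendsto_powr_exp_at_top:
  fixes a c :: real
  assumes "0 < c"
  shows "((\<lambda>t. t powr a * exp (- (c * t))) \<longlongrightarrow> 0) at_top"
proof -
  define k where "k = nat \<lceil>a\<rceil>"
  have "((\<lambda>t. inverse (c ^ k) * ((c * t) ^ k / exp (c * t))) \<longlongrightarrow> inverse (c ^ k) * 0) at_top"
    using assms by (intro tendsto_mult tendsto_const filterlim_compose[OF tendsto_power_div_exp_0]
      filterlim_tendsto_pos_mult_at_top[OF tendsto_const] filterlim_ident)
  hence lim: "((\<lambda>t. t ^ k * exp (- (c * t))) \<longlongrightarrow> 0) at_top"
    using assms by (simp add: power_mult_distrib exp_minus field_simps)
  show ?thesis
  proof (rule Lim_null_comparison[OF _ lim])
    show "\<forall>\<^sub>F t in at_top. norm (t powr a * exp (- (c * t))) \<le> t ^ k * exp (- (c * t))"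
      using eventually_ge_at_top[of 1]
    proof eventually_elim
      case (elim t)
      have "t powr a \<le> t powr real k" using elim by (intro powr_mono) (use k_def in \<open>linarith | simp\<close>)+
      also have "\<dots> = t ^ k" using elim by (simp add: powr_realpow)
      finally show ?case by (simp add: abs_mult mult_right_mono)
    qed
  qed
qed

text \<open>Integration by parts against \<open>t powr s\<close>; the relation carries the Mellin transform one strip to
  the left, where only the zero of \<open>(1 - exp (- t)) ^ Suc q\<close> at 0 makes the integral converge.\<close>

lemma LBINT_mellin_kernel_parts:
  assumes s: "- real (Suc q) < Re s" and c: "0 < c"
  shows "s * (LBINT t:{0<..}. mellin_kernel (Suc q) s c t) =
    of_real c * (LBINT t:{0<..}. mellin_kernel (Suc q) (s + 1) c t)
    - of_nat (Suc q) * (LBINT t:{0<..}. mellin_kernel q (s + 1) (c + 1) t)"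
proof -
  \<comment> \<open>The primitive for the fundamental theorem. Both boundary values vanish: near 0
    it is bounded by a power of \<open>t\<close> whose exponent \<open>Re s + q + 1\<close> is
    positive by \<open>s\<close>, and at infinity the exponential wins.\<close>
  define F where "F = (\<lambda>t. complex_of_real t powr s * of_real (exp (- (c * t)) * (1 - exp (- t)) ^ Suc q))"
  define f where "f = (\<lambda>t. s * mellin_kernel (Suc q) s c t -
     (of_real c * mellin_kernel (Suc q) (s + 1) c t - of_nat (Suc q) * mellin_kernel q (s + 1) (c + 1) t))"
  have i1: "set_integrable lborel {0<..} (mellin_kernel (Suc q) s c)"
    "set_integrable lborel {0<..} (mellin_kernel (Suc q) (s + 1) c)"
    "set_integrable lborel {0<..} (mellin_kernel q (s + 1) (c + 1))"
    using s c by (intro set_integrable_mellin_kernel; simp)+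
  have fint: "set_integrable lborel {0<..} f"
    unfolding f_def by (intro set_integral_diff set_integrable_mult_right i1)
  have bnd: "norm (F t) \<le> t powr (Re s + real (Suc q)) * exp (- (c * t))" if "0 < t" for t
  proof -
    have "norm (F t) \<le> t powr Re s * (t ^ Suc q * exp (- (c * t)))"
      unfolding F_def norm_mult[of "_ powr _"]
      using that by (intro mult_mono mellin_factor_bound) (auto simp: norm_powr_real_powr)
    thus ?thesis using powr_times_power[OF that, of "Re s" "Suc q"] by (simp add: mult.assoc[symmetric])
  qed
  have "(LBINT t=0..\<infinity>. f t) = 0 - 0"
  proof (rule interval_integral_FTC_integrable)
    fix t :: real assume "0 < ereal t"
    hence t: "0 < t" by simp
    have nz: "complex_of_real t \<notin> \<real>\<^sub>\<le>\<^sub>0" using t by auto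
    have "(F has_vector_derivative
        (s * of_real t powr (s - 1) * of_real (exp (- (c * t)) * (1 - exp (- t)) ^ Suc q) +
        of_real t powr s * of_real (- c * exp (- (c * t)) * (1 - exp (- t)) ^ Suc q
          + exp (- (c * t)) * (real (Suc q) * (1 - exp (- t)) ^ q * exp (- t))))) (at t)"
    proof -
      have 1: "((\<lambda>t. complex_of_real t powr s) has_vector_derivative s * of_real t powr (s - 1)) (at t)"
        using nz by (intro has_vector_derivative_real_field) (auto intro!: derivative_eq_intros)
      have 2: "((\<lambda>t. exp (- (c * t)) * (1 - exp (- t)) ^ Suc q) has_real_derivative
          (- c * exp (- (c * t)) * (1 - exp (- t)) ^ Suc q
          + exp (- (c * t)) * (real (Suc q) * (1 - exp (- t)) ^ q * exp (- t)))) (at t)"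
        by (rule derivative_eq_intros refl | simp)+
      have 3: "((\<lambda>t. complex_of_real (exp (- (c * t)) * (1 - exp (- t)) ^ Suc q)) has_vector_derivative
          of_real (- c * exp (- (c * t)) * (1 - exp (- t)) ^ Suc q
          + exp (- (c * t)) * (real (Suc q) * (1 - exp (- t)) ^ q * exp (- t)))) (at t)"
        using 2 by (intro has_vector_derivative_of_real) (simp add: has_real_derivative_iff_has_vector_derivative)
      show ?thesis unfolding F_def
        using has_vector_derivative_mult[OF 1 3] by (simp only: add.commute mult.assoc)
    qed
    also have "(s * of_real t powr (s - 1) * of_real (exp (- (c * t)) * (1 - exp (- t)) ^ Suc q) +
        of_real t powr s * of_real (- c * exp (- (c * t)) * (1 - exp (- t)) ^ Suc q
          + exp (- (c * t)) * (real (Suc q) * (1 - exp (- t)) ^ q * exp (- t)))) = f t"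
    proof -
      have e: "exp (- ((c + 1) * t)) = exp (- (c * t)) * exp (- t)"
        by (simp add: algebra_simps flip: exp_add)
      show ?thesis unfolding f_def mellin_kernel_def e
        by (simp add: algebra_simps del: of_nat_Suc power_Suc)
    qed
    finally show "(F has_vector_derivative f t) (at t)" .
    show "isCont f t" unfolding f_def mellin_kernel_def
      using nz t by (intro continuous_intros) auto
  next
    show "set_integrable lborel (einterval 0 \<infinity>) f"
      using fint by (simp add: einterval_def greaterThan_def)
    have "(F \<longlongrightarrow> 0) (at_right 0)"
    proof (rule Lim_null_comparison)
      show "\<forall>\<^sub>F t in at_right 0. norm (F t) \<le> t powr (Re s + real (Suc q)) * exp (- (c * t))"
        using bnd by (auto simp: eventually_at_right_less intro: eventually_mono[OF eventually_at_right_less])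
      show "((\<lambda>t. t powr (Re s + real (Suc q)) * exp (- (c * t))) \<longlongrightarrow> 0) (at_right 0)"
      proof -
        have "((\<lambda>t::real. t powr (Re s + real (Suc q))) \<longlongrightarrow> 0) (at_right 0)"
          using s by (intro tendsto_eq_intros tendsto_powr2[OF tendsto_ident_at tendsto_const, THEN tendsto_eq_rhs]) (auto simp: eventually_at_filter)
        moreover have "((\<lambda>t::real. exp (- (c * t))) \<longlongrightarrow> exp (- (c * 0))) (at_right 0)"
          by (intro tendsto_intros)
        ultimately show ?thesis using tendsto_mult by fastforce
      qed
    qed
    thus "((F \<circ> real_of_ereal) \<longlongrightarrow> 0) (at_right 0)"
      by (simp add: ereal_tendsto_simps zero_ereal_def)
    have "(F \<longlongrightarrow> 0) at_top"
    proof (rule Lim_null_comparison)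
      show "\<forall>\<^sub>F t in at_top. norm (F t) \<le> t powr (Re s + real (Suc q)) * exp (- (c * t))"
        using bnd by (auto intro: eventually_mono[OF eventually_gt_at_top])
      show "((\<lambda>t. t powr (Re s + real (Suc q)) * exp (- (c * t))) \<longlongrightarrow> 0) at_top"
        by (rule tendsto_powr_exp_at_top[OF c])
    qed
    thus "((F \<circ> real_of_ereal) \<longlongrightarrow> 0) (at_left \<infinity>)"
      by (simp add: ereal_tendsto_simps)
  qed simp
  hence "(LBINT t:{0<..}. f t) = 0"
    by (simp add: interval_lebesgue_integral_0_infty)
  moreover have "(LBINT t:{0<..}. f t) = (LBINT t:{0<..}. s * mellin_kernel (Suc q) s c t) -
    ((LBINT t:{0<..}. of_real c * mellin_kernel (Suc q) (s + 1) c t)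
    - (LBINT t:{0<..}. of_nat (Suc q) * mellin_kernel q (s + 1) (c + 1) t))"
    unfolding f_def
    by (subst set_integral_diff(2)[OF set_integrable_mult_right[OF i1(1)]
          set_integral_diff(1)[OF set_integrable_mult_right[OF i1(2)] set_integrable_mult_right[OF i1(3)]]],
        subst set_integral_diff(2)[OF set_integrable_mult_right[OF i1(2)] set_integrable_mult_right[OF i1(3)]])
       (rule refl)
  ultimately show ?thesis by (simp del: of_nat_Suc)
qed

text \<open>Induction over strips of width one. The relation
  \<open>rGamma s = rGamma (s + 1) * s\<close> involves no division, so non-positive integers
  \<open>s\<close> are covered as well. The number \<open>n\<close> of strips is kept apart from
  \<open>q\<close>, because a step keeps \<open>q\<close> in one term and lowers it in the
  other.\<close>

lemma rGamma_LBINT_mellin_kernel: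
  assumes "- real q < Re s" "0 < c"
  shows "rGamma s * (LBINT t:{0<..}. mellin_kernel q s c t) = mellin_value q s c"
proof -
  have "rGamma s * (LBINT t:{0<..}. mellin_kernel q s c t) = mellin_value q s c" if "- real n < Re s" for n
    using that assms
  proof (induction n arbitrary: q s c)
    case 0
    hence "0 < Re s" by simp
    hence "s \<notin> \<int>\<^sub>\<le>\<^sub>0" by (auto elim!: nonpos_Ints_cases)
    hence "rGamma s * Gamma s = 1"
      using Gamma_eq_zero_iff[of s] by (simp add: rGamma_inverse_Gamma)
    with LBINT_mellin_kernel_right[OF \<open>0 < Re s\<close> \<open>0 < c\<close>] show ?case by simp
  next
    case (Suc n)
    show ?case
    proof (cases q)
      case 0
      then show ?thesis using Suc.IH[of s q c] Suc.prems by simp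
    next
      case q: (Suc q')
      have "rGamma s * (LBINT t:{0<..}. mellin_kernel q s c t) =
          rGamma (s + 1) * (s * (LBINT t:{0<..}. mellin_kernel (Suc q') s c t))"
      proof -
        have r: "rGamma s = rGamma (s + 1) * s" using rGamma_plus1[of s] by (simp add: mult.commute)
        show ?thesis unfolding q by (subst r) (rule mult.assoc)
      qed
      also have "\<dots> = of_real c * (rGamma (s + 1) * (LBINT t:{0<..}. mellin_kernel (Suc q') (s + 1) c t))
         - of_nat (Suc q') * (rGamma (s + 1) * (LBINT t:{0<..}. mellin_kernel q' (s + 1) (c + 1) t))"
        using Suc.prems unfolding q by (subst LBINT_mellin_kernel_parts) (simp_all add: right_diff_distrib mult.left_commute del: of_nat_Suc)
      also have "\<dots> = mellin_value q s c"
        unfolding q mellin_value_shift[OF Suc.prems(3), of q' s]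
        using Suc.prems Suc.IH[of "s + 1" "Suc q'" c] Suc.IH[of "s + 1" q' "c + 1"] by (simp add: q)
      finally show ?thesis .
    qed
  qed
  from this[of q] assms show ?thesis by simp
qed

section \<open>Exponential power series in several variables\<close>

lemma has_sum_times:
  fixes f g :: "_ \<Rightarrow> complex"
  assumes "(f has_sum S) A" "(g has_sum T) B"
  shows "((\<lambda>(x, y). f x * g y) has_sum (S * T)) (A \<times> B)"
proof (rule has_sum_SigmaI)
  show "((\<lambda>y. case (x, y) of (x, y) \<Rightarrow> f x * g y) has_sum (f x * T)) B" if "x \<in> A" for x
    using has_sum_cmult_right[OF assms(2)] by simp
  show "((\<lambda>x. f x * T) has_sum S * T) A"
    by (rule has_sum_cmult_left[OF assms(1)])
  have "(\<lambda>x. norm (f x)) summable_on A" "(\<lambda>x. norm (g x)) summable_on B"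
    using assms by (auto intro: summable_on_iff_abs_summable_on_complex[THEN iffD1] has_sum_imp_summable)
  hence "(\<lambda>p. norm (case p of (x, y) \<Rightarrow> f x * g y)) summable_on A \<times> B"
    unfolding Infinite_Sum.abs_summable_on_Sigma_iff
    by (auto simp: norm_mult infsum_cmult_right' abs_mult intro!: summable_on_cmult_right summable_on_cmult_left)
  thus "(\<lambda>(x, y). f x * g y) summable_on A \<times> B"
    by (rule summable_on_iff_abs_summable_on_complex[THEN iffD2])
qed

lemma has_sum_sum:
  assumes "finite I" "\<And>i. i \<in> I \<Longrightarrow> (f i has_sum S i) A"
  shows "((\<lambda>x. \<Sum>i\<in>I. f i x) has_sum (\<Sum>i\<in>I. S i :: 'a :: topological_comm_monoid_add)) A"
  using assms by (induction I rule: finite_induct) (auto intro: has_sum_add)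

lemma has_sum_exp: "((\<lambda>n. z ^ n / fact n) has_sum exp z) UNIV" for z :: complex
proof (rule norm_summable_imp_has_sum)
  show "summable (\<lambda>n. norm (z ^ n / fact n))"
    using summable_norm_exp[of z] by (simp add: scaleR_conv_of_real divide_inverse mult.commute)
  show "(\<lambda>n. z ^ n / fact n) sums exp z"
    using exp_converges[of z] by (simp add: scaleR_conv_of_real divide_inverse mult.commute)
qed

section \<open>Suffix sums and exponential monomials\<close>

primrec suffix_sums :: "'a::comm_monoid_add list \<Rightarrow> 'a list" where
  "suffix_sums [] = []"
| "suffix_sums (x # xs) = sum_list (x # xs) # suffix_sums xs"

lemma length_suffix_sums [simp]: "length (suffix_sums xs) = length xs"
  by (induction xs) auto

lemma suffix_sums_nth: "j < length xs \<Longrightarrow> suffix_sums xs ! j = (\<Sum>\<nu> = j..<length xs. xs ! \<nu>)"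
proof (induction xs arbitrary: j)
  case (Cons x xs)
  show ?case
  proof (cases j)
    case 0
    have "(\<Sum>\<nu> = 0..<length (x # xs). (x # xs) ! \<nu>) = sum_list (x # xs)"
      by (rule sum_list_sum_nth[symmetric])
    then show ?thesis using 0 by simp
  next
    case (Suc i)
    have "(\<Sum>\<nu> = Suc i..<Suc (length xs). (x # xs) ! \<nu>) = (\<Sum>\<nu> = i..<length xs. xs ! \<nu>)"
      by (subst sum.shift_bounds_Suc_ivl) simp
    then show ?thesis using Cons Suc by simp
  qed
qed auto

lemma suffix_sums_snoc: "suffix_sums (xs @ [x]) = map ((+) x) (suffix_sums xs) @ [x]"
  by (induction xs) (auto simp: add_ac)

lemma suffix_sums_replicate_1: "set (suffix_sums (replicate r (1::complex))) \<subseteq> of_nat ` {..r}"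
proof (induction r)
  case (Suc r)
  have "1 + of_nat r = (of_nat (Suc r) :: complex)" by simp
  hence "1 + of_nat r \<in> (of_nat ` {..Suc r} :: complex set)" by blast
  with Suc show ?case by (auto simp: sum_list_replicate)
qed simp

lemma sum_list_uminus: "sum_list (map uminus xs) = - sum_list xs" for xs :: "'a::ab_group_add list"
  by (induction xs) auto

lemma suffix_sums_uminus: "suffix_sums (map uminus xs) = map uminus (suffix_sums xs)"
  for xs :: "'a::ab_group_add list"
  by (induction xs) (auto simp: sum_list_uminus)

lemma norm_suffix_sums_le:
  fixes xs :: "'a::real_normed_vector list"
  assumes "\<And>x. x \<in> set xs \<Longrightarrow> norm x \<le> \<epsilon>" "0 \<le> \<epsilon>" "y \<in> set (suffix_sums xs)"
  shows "norm y \<le> real (length xs) * \<epsilon>"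
  using assms(1,3)
proof (induction xs)
  case (Cons x xs)
  have "norm (sum_list ys) \<le> sum_list (map norm ys)" for ys :: "'a list"
    by (induction ys) (auto intro: norm_triangle_le)
  hence "norm (sum_list (x # xs)) \<le> sum_list (map norm (x # xs))" .
  also have "\<dots> \<le> sum_list (map (\<lambda>_. \<epsilon>) (x # xs))"
    by (rule sum_list_mono) (use Cons.prems in auto)
  also have "\<dots> = real (length (x # xs)) * \<epsilon>"
    by (simp add: sum_list_triv algebra_simps)
  finally have "norm (sum_list (x # xs)) \<le> real (length (x # xs)) * \<epsilon>" .
  moreover have "norm y \<le> real (length (x # xs)) * \<epsilon>" if "y \<in> set (suffix_sums xs)"
    using Cons that assms(2) by (force simp: algebra_simps)
  ultimately show ?case using Cons.prems(2) by auto
qed simp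

definition exp_monom :: "complex list \<Rightarrow> nat list \<Rightarrow> complex" where
  "exp_monom xs ms = (\<Prod>j<length xs. xs ! j ^ (ms ! j) / fact (ms ! j))"

lemma exp_monom_Nil [simp]: "exp_monom [] ms = 1"
  by (simp add: exp_monom_def)

lemma exp_monom_Cons: "exp_monom (x # xs) (m # ms) = x ^ m / fact m * exp_monom xs ms"
  unfolding exp_monom_def by (simp add: prod.lessThan_Suc_shift del: prod.lessThan_Suc)

lemma exp_monom_snoc:
  "length ms = length xs \<Longrightarrow> exp_monom (xs @ [x]) (ms @ [m]) = exp_monom xs ms * (x ^ m / fact m)"
  by (simp add: exp_monom_def nth_append)

lemma exp_monom_uminus:
  "length ms = length xs \<Longrightarrow> exp_monom (map uminus xs) ms = (-1) ^ sum_list ms * exp_monom xs ms"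
proof (induction ms xs rule: list_induct2)
  case (Cons m ms x xs)
  then show ?case by (simp add: exp_monom_Cons power_minus[of x] power_add)
qed simp

lemma norm_exp_monom_le:
  "length ms = length xs \<Longrightarrow> (\<And>x. x \<in> set xs \<Longrightarrow> norm x \<le> \<epsilon>) \<Longrightarrow> 0 \<le> \<epsilon> \<Longrightarrow>
    norm (exp_monom xs ms) \<le> \<epsilon> ^ sum_list ms * norm (exp_monom (replicate (length xs) 1) ms)"
proof (induction ms xs rule: list_induct2)
  case (Cons m ms x xs)
  have "norm (exp_monom (x # xs) (m # ms)) = norm x ^ m / fact m * norm (exp_monom xs ms)"
    by (simp add: exp_monom_Cons norm_mult norm_divide norm_power)
  also have "\<dots> \<le> \<epsilon> ^ m / fact m * (\<epsilon> ^ sum_list ms * norm (exp_monom (replicate (length xs) 1) ms))"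
    using Cons by (intro mult_mono divide_right_mono power_mono) auto
  also have "\<dots> = \<epsilon> ^ sum_list (m # ms) * norm (exp_monom (replicate (length (x # xs)) 1) (m # ms))"
    by (simp add: exp_monom_Cons norm_mult norm_divide power_add)
  finally show ?case .
qed simp

lemma bij_betw_snoc:
  "bij_betw (\<lambda>(ms, m). ms @ [m]) ({ms. length ms = r} \<times> UNIV) {ms. length ms = Suc r}"
proof (rule bij_betw_byWitness[where f' = "\<lambda>ms. (butlast ms, last ms)"])
  show "\<forall>ms\<in>{ms. length ms = Suc r}. (case (butlast ms, last ms) of (ms, m) \<Rightarrow> ms @ [m]) = ms"
    by (auto simp: append_butlast_last_id simp flip: length_greater_0_conv)
qed auto

text \<open>For a chain \<open>m_1 \<le> ... \<le> m_r = N\<close> and \<open>m_0 = 0\<close>,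
  summation by parts gives \<open>\<Sum> m_j x_j = \<Sum> (m_j - m_(j-1)) (x_j + ... + x_r)\<close>,
  and the differences are exponents of total degree \<open>N\<close>. The induction appends a
  variable \<open>x\<close>: this adds \<open>x\<close> to all suffix sums, which by homogeneity
  multiplies the symmetric polynomial of degree \<open>i\<close> by
  \<open>exp x ^ i\<close>.\<close>

lemma has_sum_weak_sum:
  "((\<lambda>ms. of_nat (weak_sum (rev ms) N) * exp_monom xs ms) has_sum complete_symm (map exp (suffix_sums xs)) N)
     {ms. length ms = length xs}"
proof (induction xs arbitrary: N rule: rev_induct)
  case Nil
  have "{ms::nat list. length ms = length ([]::complex list)} = {[]}" by auto
  then show ?case by (simp add: has_sum_finiteI)
next
  case (snoc x xs)
  define r where "r = length xs"
  have "((\<lambda>ms. \<Sum>i\<le>N. of_nat (weak_sum (rev ms) i) * exp_monom xs ms) has_sum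
      (\<Sum>i\<le>N. complete_symm (map exp (suffix_sums xs)) i)) {ms. length ms = r}"
    unfolding r_def by (intro has_sum_sum snoc.IH) auto
  from has_sum_times[OF this has_sum_exp[of "of_nat N * x"]]
  have "((\<lambda>(ms, m). (\<Sum>i\<le>N. of_nat (weak_sum (rev ms) i) * exp_monom xs ms) * ((of_nat N * x) ^ m / fact m))
     has_sum ((\<Sum>i\<le>N. complete_symm (map exp (suffix_sums xs)) i) * exp (of_nat N * x))) ({ms. length ms = r} \<times> UNIV)" .
  also have "?this \<longleftrightarrow> ((\<lambda>p. of_nat (weak_sum (rev ((\<lambda>(ms, m). ms @ [m]) p)) N) * exp_monom (xs @ [x]) ((\<lambda>(ms, m). ms @ [m]) p))
     has_sum ((\<Sum>i\<le>N. complete_symm (map exp (suffix_sums xs)) i) * exp (of_nat N * x))) ({ms. length ms = r} \<times> UNIV)"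
    by (intro has_sum_cong) (auto simp: r_def exp_monom_snoc power_mult_distrib sum_distrib_left sum_distrib_right mult_ac)
  also have "\<dots> \<longleftrightarrow> ((\<lambda>ms. of_nat (weak_sum (rev ms) N) * exp_monom (xs @ [x]) ms)
     has_sum ((\<Sum>i\<le>N. complete_symm (map exp (suffix_sums xs)) i) * exp (of_nat N * x))) {ms. length ms = Suc r}"
    by (rule has_sum_reindex_bij_betw[OF bij_betw_snoc])
  also have "(\<Sum>i\<le>N. complete_symm (map exp (suffix_sums xs)) i) * exp (of_nat N * x) = complete_symm (map exp (suffix_sums (xs @ [x]))) N"
  proof -
    have "map exp (suffix_sums (xs @ [x])) = map ((*) (exp x)) (map exp (suffix_sums xs)) @ [exp x]"
      by (simp add: suffix_sums_snoc exp_add)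
    moreover have *: "exp x ^ N = exp x ^ i * exp x ^ (N - i)" if "i \<le> N" for i
      using that by (simp flip: power_add)
    ultimately show ?thesis
      by (simp only: complete_symm_snoc complete_symm_scale exp_of_nat_mult sum_distrib_right)
         (intro sum.cong refl, simp add: * mult_ac)
  qed
  finally show ?case by (simp add: r_def)
qed

text \<open>The weak sums are taken at \<open>map uminus xs\<close>, where the change of sign in the
  monomials absorbs \<open>(-1) ^ sum_list ms\<close>.\<close>

lemma has_sum_polylog_coeff:
  assumes "xs \<noteq> []"
  shows "((\<lambda>ms. of_int (polylog_coeff (rev ms) n) * exp_monom xs ms) has_sum
     complete_symm (map (\<lambda>x. 1 - exp (- x)) (suffix_sums xs)) n) {ms. length ms = length xs}"
proof -
  define q where "q = length xs - 1"
  have q: "length xs = Suc q" using assms by (simp add: q_def)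
  let ?ys = "map uminus xs" and ?c = "\<lambda>N. (-1) ^ N * of_nat ((n + q) choose (N + q)) :: complex"
  have "((\<lambda>ms. \<Sum>N\<le>n. ?c N * (of_nat (weak_sum (rev ms) N) * exp_monom ?ys ms)) has_sum
      (\<Sum>N\<le>n. ?c N * complete_symm (map exp (suffix_sums ?ys)) N)) {ms. length ms = length ?ys}"
    by (intro has_sum_sum has_sum_cmult_right has_sum_weak_sum) auto
  also have "?this \<longleftrightarrow> ((\<lambda>ms. of_int (polylog_coeff (rev ms) n) * exp_monom xs ms) has_sum
      (\<Sum>N\<le>n. ?c N * complete_symm (map exp (suffix_sums ?ys)) N)) {ms. length ms = length ?ys}"
  proof (intro has_sum_cong)
    fix ms :: "nat list" assume "ms \<in> {ms. length ms = length ?ys}"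
    hence len: "length ms = length xs" by simp
    with q obtain k ks where ks: "rev ms = k # ks" by (metis length_Suc_conv length_rev)
    have lk: "length ks = q" using len q ks by (metis Suc_inject length_Cons length_rev)
    have "complex_of_int (polylog_coeff (rev ms) n) = (-1) ^ sum_list (rev ms) * (\<Sum>N\<le>n. ?c N * of_nat (weak_sum (rev ms) N))"
      unfolding polylog_coeff_eq_weak_sum[OF ks] lk by simp
    thus "(\<Sum>N\<le>n. ?c N * (of_nat (weak_sum (rev ms) N) * exp_monom ?ys ms)) = of_int (polylog_coeff (rev ms) n) * exp_monom xs ms"
      by (simp add: exp_monom_uminus[OF len] sum_list_rev sum_distrib_left sum_distrib_right mult_ac)
  qed
  also have "(\<Sum>N\<le>n. ?c N * complete_symm (map exp (suffix_sums ?ys)) N) = complete_symm (map (\<lambda>x. 1 - exp (- x)) (suffix_sums xs)) n"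
  proof -
    obtain v vs where v: "map exp (suffix_sums ?ys) = v # vs" and vl: "length vs = q"
      using q by (metis length_Suc_conv length_map length_suffix_sums)
    show ?thesis
      using complete_symm_one_minus[OF v, of n] unfolding vl by (simp add: suffix_sums_uminus comp_def)
  qed
  finally show ?thesis by simp
qed

text \<open>The coefficients of order \<open>n\<close> vanish in total degree below \<open>n\<close>, so a crude bound at the point
  \<open>(1, \<dots>, 1)\<close> improves by a factor \<open>\<epsilon> ^ n\<close> on the polydisc of radius \<open>\<epsilon>\<close>.\<close>

lemma norm_polylog_coeff_series_bound:
  assumes "\<And>x. x \<in> set xs \<Longrightarrow> norm x \<le> \<epsilon>" "0 \<le> \<epsilon>" "\<epsilon> \<le> 1" "length xs = Suc q"
  shows "(\<lambda>ms. norm (of_int (polylog_coeff (rev ms) n) * exp_monom xs ms)) summable_on {ms. length ms = length xs}"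
    and "infsum (\<lambda>ms. norm (of_int (polylog_coeff (rev ms) n) * exp_monom xs ms)) {ms. length ms = length xs}
      \<le> 2 ^ q * (2 * (2 * exp (real (Suc q))) ^ Suc q * \<epsilon>) ^ n"
proof -
  have "xs \<noteq> []" using assms by auto
  from has_sum_imp_summable[OF has_sum_polylog_coeff[OF this]]
  show sm: "(\<lambda>ms. norm (of_int (polylog_coeff (rev ms) n) * exp_monom xs ms)) summable_on {ms. length ms = length xs}"
    by (simp add: summable_on_iff_abs_summable_on_complex)
  let ?os = "replicate (length xs) (1::complex)"
  let ?h = "complete_symm (map exp (suffix_sums ?os))"
  \<comment> \<open>A majorant without signs, taken at the point (1, ..., 1); there all terms are
    nonnegative, so the sum of the norms is the norm of the sum.\<close>
  define g where "g = (\<lambda>ms. \<epsilon> ^ n * (\<Sum>N\<le>n. real ((n + q) choose (N + q)) * norm (of_nat (weak_sum (rev ms) N) * exp_monom ?os ms)))"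
  have hs: "((\<lambda>ms. norm (of_nat (weak_sum (rev ms) N) * exp_monom ?os ms)) has_sum norm (?h N)) {ms. length ms = length xs}" for N
  proof -
    have *: "of_nat (weak_sum (rev ms) N) * exp_monom ?os ms = of_real (norm (of_nat (weak_sum (rev ms) N) * exp_monom ?os ms))"
      if "length ms = length xs" for ms
    proof -
      have "exp_monom ?os ms = of_real (\<Prod>j<length xs. 1 / fact (ms ! j))"
        by (simp add: exp_monom_def)
      moreover have "(\<Prod>j<length xs. 1 / fact (ms ! j)) \<ge> (0::real)"
        by (intro prod_nonneg) auto
      ultimately show ?thesis
        by (simp only: norm_mult norm_of_nat norm_of_real abs_of_nonneg of_real_mult of_real_of_nat_eq)
    qed
    have 0: "((\<lambda>ms. of_nat (weak_sum (rev ms) N) * exp_monom ?os ms) has_sum ?h N) {ms. length ms = length xs}"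
      using has_sum_weak_sum[of N ?os] by (simp only: length_replicate)
    have C: "((\<lambda>ms. of_real (norm (of_nat (weak_sum (rev ms) N) * exp_monom ?os ms)) :: complex) has_sum ?h N) {ms. length ms = length xs}"
      by (rule has_sum_cong[THEN iffD1, OF _ 0], rule *, simp)
    have 1: "((\<lambda>ms. norm (of_nat (weak_sum (rev ms) N) * exp_monom ?os ms)) has_sum Re (?h N)) {ms. length ms = length xs}"
      using has_sum_Re[OF C] by (simp only: Re_complex_of_real)
    have "norm (?h N) = norm (complex_of_real (Re (?h N)))"
      by (rule arg_cong[OF has_sum_unique[OF C has_sum_of_real[OF 1]]])
    moreover have "0 \<le> Re (?h N)" by (rule has_sum_nonneg[OF 1]) (rule norm_ge_zero)
    ultimately have "Re (?h N) = norm (?h N)"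
      by (simp only: norm_of_real abs_of_nonneg)
    with 1 show ?thesis by (simp only:)
  qed
  have gs: "(g has_sum (\<epsilon> ^ n * (\<Sum>N\<le>n. real ((n + q) choose (N + q)) * norm (?h N)))) {ms. length ms = length xs}"
    unfolding g_def by (intro has_sum_cmult_right has_sum_sum hs) auto
  have "infsum (\<lambda>ms. norm (of_int (polylog_coeff (rev ms) n) * exp_monom xs ms)) {ms. length ms = length xs} \<le> infsum g {ms. length ms = length xs}"
  proof (intro infsum_mono sm has_sum_imp_summable[OF gs])
    fix ms :: "nat list" assume "ms \<in> {ms. length ms = length xs}"
    hence len: "length ms = length xs" by simp
    show "norm (of_int (polylog_coeff (rev ms) n) * exp_monom xs ms) \<le> g ms"
    proof (cases "sum_list ms < n")
      case True
      hence "polylog_coeff (rev ms) n = 0" by (intro polylog_coeff_eq_0) (simp add: sum_list_rev)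
      thus ?thesis using assms by (auto simp: g_def intro!: mult_nonneg_nonneg sum_nonneg)
    next
      case False
      from len assms(4) obtain k ks where ks: "rev ms = k # ks" by (metis length_Suc_conv length_rev)
      have lk: "length ks = q" using len assms(4) ks by (metis Suc_inject length_Cons length_rev)
      have "norm (complex_of_int (polylog_coeff (rev ms) n)) = \<bar>\<Sum>N\<le>n. (- 1) ^ N * real ((n + q) choose (N + q)) * real (weak_sum (rev ms) N)\<bar>"
        unfolding norm_of_int polylog_coeff_eq_weak_sum[OF ks] lk by (simp add: abs_mult)
      also have "\<dots> \<le> (\<Sum>N\<le>n. real ((n + q) choose (N + q)) * real (weak_sum (rev ms) N))"
        by (rule order_trans[OF sum_abs]) (simp add: abs_mult)
      finally have a: "norm (complex_of_int (polylog_coeff (rev ms) n)) \<le> (\<Sum>N\<le>n. real ((n + q) choose (N + q)) * real (weak_sum (rev ms) N))" .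
      have "norm (exp_monom xs ms) \<le> \<epsilon> ^ sum_list ms * norm (exp_monom ?os ms)"
        by (rule norm_exp_monom_le[OF len assms(1,2)])
      also have "\<dots> \<le> \<epsilon> ^ n * norm (exp_monom ?os ms)"
        using False assms by (intro mult_right_mono power_decreasing) auto
      finally have "norm (exp_monom xs ms) \<le> \<epsilon> ^ n * norm (exp_monom ?os ms)" .
      hence "norm (of_int (polylog_coeff (rev ms) n) * exp_monom xs ms) \<le>
        (\<Sum>N\<le>n. real ((n + q) choose (N + q)) * real (weak_sum (rev ms) N)) * (\<epsilon> ^ n * norm (exp_monom ?os ms))"
        unfolding norm_mult using a by (intro mult_mono) (auto intro!: sum_nonneg)
      also have "\<dots> = g ms"
        by (simp add: g_def norm_mult sum_distrib_left sum_distrib_right mult_ac)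
      finally show ?thesis .
    qed
  qed
  also have "\<dots> = \<epsilon> ^ n * (\<Sum>N\<le>n. real ((n + q) choose (N + q)) * norm (?h N))"
    by (rule infsumI[OF gs])
  also have "\<dots> \<le> \<epsilon> ^ n * (\<Sum>N\<le>n. real ((n + q) choose (N + q)) * ((2 * exp (real (Suc q))) ^ Suc q) ^ n)"
  proof (intro mult_left_mono sum_mono)
    fix N assume N: "N \<in> {..n}"
    \<comment> \<open>At (1, ..., 1) the suffix sums are integers between 0 and
      \<open>Suc q\<close>.\<close>
    have B: "norm w \<le> exp (real (Suc q))" if "w \<in> set (map exp (suffix_sums ?os))" for w
      using that suffix_sums_replicate_1[of "length xs"] assms(4) by (auto simp: norm_exp_eq_Re)
    have "norm (?h N) \<le> real (Suc N) ^ length (map exp (suffix_sums ?os)) * exp (real (Suc q)) ^ N"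
      by (rule norm_complete_symm_le[OF B]) auto
    also have "\<dots> = real (Suc N) ^ Suc q * exp (real (Suc q)) ^ N"
      using assms(4) by simp
    \<comment> \<open>Wasteful on purpose: \<open>Suc N \<le> 2 ^ n\<close> and the extra exponent
      \<open>Suc q\<close> on the exponential make the bound an \<open>n\<close>-th power of a
      single constant.\<close>
    also have "\<dots> \<le> (2 ^ n) ^ Suc q * (exp (real (Suc q)) ^ Suc q) ^ n"
    proof (intro mult_mono power_mono)
      have "Suc N \<le> 2 ^ N" by (induction N) auto
      also have "(2::nat) ^ N \<le> 2 ^ n" using N by (intro power_increasing) auto
      finally show "real (Suc N) \<le> 2 ^ n" by (metis of_nat_le_iff of_nat_numeral of_nat_power)
      have "exp (real (Suc q)) ^ N \<le> exp (real (Suc q)) ^ n"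
        using N by (intro power_increasing) auto
      also have "\<dots> \<le> (exp (real (Suc q)) ^ Suc q) ^ n"
      proof (intro power_mono)
        show "exp (real (Suc q)) \<le> exp (real (Suc q)) ^ Suc q"
          using power_increasing[of 1 "Suc q" "exp (real (Suc q))"] by simp
      qed auto
      finally show "exp (real (Suc q)) ^ N \<le> (exp (real (Suc q)) ^ Suc q) ^ n" .
    qed auto
    also have "\<dots> = ((2 * exp (real (Suc q))) ^ Suc q) ^ n"
    proof -
      have "((2::real) ^ n) ^ Suc q = (2 ^ Suc q) ^ n"
        by (simp only: power_mult[symmetric] mult.commute)
      thus ?thesis by (simp only: power_mult_distrib)
    qed
    finally show "norm (?h N) \<le> ((2 * exp (real (Suc q))) ^ Suc q) ^ n" .
  qed (use assms in auto)
  also have "\<dots> = \<epsilon> ^ n * ((\<Sum>N\<le>n. real ((n + q) choose (N + q))) * ((2 * exp (real (Suc q))) ^ Suc q) ^ n)"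
    by (simp only: sum_distrib_right)
  also have "\<dots> \<le> \<epsilon> ^ n * (2 ^ (n + q) * ((2 * exp (real (Suc q))) ^ Suc q) ^ n)"
  proof (intro mult_left_mono mult_right_mono)
    have "(\<Sum>N\<le>n. (n + q) choose (N + q)) = (\<Sum>i\<in>(\<lambda>N. N + q) ` {..n}. (n + q) choose i)"
      by (subst sum.reindex) (auto simp: inj_on_def)
    also have "\<dots> \<le> (\<Sum>i\<le>n + q. (n + q) choose i)"
      by (intro sum_mono2) auto
    also have "\<dots> = 2 ^ (n + q)" by (rule choose_row_sum)
    finally show "(\<Sum>N\<le>n. real ((n + q) choose (N + q))) \<le> 2 ^ (n + q)"
      by (metis of_nat_le_iff of_nat_numeral of_nat_power of_nat_sum)
  qed (use assms in auto)
  also have "\<dots> = 2 ^ q * (2 * (2 * exp (real (Suc q))) ^ Suc q * \<epsilon>) ^ n"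
    by (simp only: power_mult_distrib power_add mult_ac)
  finally show "infsum (\<lambda>ms. norm (of_int (polylog_coeff (rev ms) n) * exp_monom xs ms)) {ms. length ms = length xs}
      \<le> 2 ^ q * (2 * (2 * exp (real (Suc q))) ^ Suc q * \<epsilon>) ^ n" .
qed

section \<open>The expansion defining the poly-Bernoulli coefficients\<close>

lemma finite_weak_compositions: "finite {ns::nat list. length ns = r \<and> sum_list ns = n}"
proof (rule finite_subset)
  show "{ns::nat list. length ns = r \<and> sum_list ns = n} \<subseteq> {ns. set ns \<subseteq> {..n} \<and> length ns = r}"
    using member_le_sum_list by auto
qed (rule finite_lists_length_eq, simp)

lemma complete_symm_eq_sum:
  "complete_symm ws n = (\<Sum>ns | length ns = length ws \<and> sum_list ns = n. \<Prod>j<length ws. ws ! j ^ (ns ! j))"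
proof (induction ws arbitrary: n)
  case Nil
  have "{ns::nat list. length ns = length ([]::'a list) \<and> sum_list ns = n} = (if n = 0 then {[]} else {})"
    by auto
  then show ?case by simp
next
  case (Cons w ws)
  let ?C = "\<lambda>n. {ns. length ns = length ws \<and> sum_list ns = n}"
  have "complete_symm (w # ws) n = (\<Sum>i\<le>n. \<Sum>ns\<in>?C (n - i). w ^ i * (\<Prod>j<length ws. ws ! j ^ (ns ! j)))"
    by (simp add: Cons sum_distrib_left)
  also have "\<dots> = (\<Sum>(i, ns)\<in>(SIGMA i:{..n}. ?C (n - i)). w ^ i * (\<Prod>j<length ws. ws ! j ^ (ns ! j)))"
    by (rule sum.Sigma) (auto intro: finite_weak_compositions)
  also have "\<dots> = (\<Sum>ns | length ns = length (w # ws) \<and> sum_list ns = n. \<Prod>j<length (w # ws). (w # ws) ! j ^ (ns ! j))"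
    by (rule sum.reindex_bij_witness[where i = "\<lambda>ns. (hd ns, tl ns)" and j = "\<lambda>(i, ns). i # ns"])
       (auto simp: length_Suc_conv prod.lessThan_Suc_shift simp del: prod.lessThan_Suc)
  finally show ?case .
qed

lemma has_sum_compositions:
  fixes \<phi> :: "nat \<Rightarrow> complex"
  assumes "(\<lambda>n. norm (\<phi> n) * complete_symm (map norm ws) n) summable_on UNIV"
  shows "((\<lambda>ns. \<phi> (sum_list ns) * (\<Prod>j<length ws. ws ! j ^ (ns ! j))) has_sum (\<Sum>\<^sub>\<infinity>n. \<phi> n * complete_symm ws n))
     {ns. length ns = length ws}"
proof -
  let ?C = "\<lambda>n. {ns. length ns = length ws \<and> sum_list ns = n}"
  let ?f = "\<lambda>ns. \<phi> (sum_list ns) * (\<Prod>j<length ws. ws ! j ^ (ns ! j))"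
  have bij: "bij_betw snd (SIGMA n:UNIV. ?C n) {ns. length ns = length ws}"
    by (rule bij_betw_byWitness[where f' = "\<lambda>ns. (sum_list ns, ns)"]) auto
  have "(\<lambda>p. norm (?f (snd p))) summable_on (SIGMA n:UNIV. ?C n)"
  proof (rule summable_on_SigmaI)
    show "((\<lambda>ns. norm (?f (snd (n, ns)))) has_sum norm (\<phi> n) * complete_symm (map norm ws) n) (?C n)" for n
      by (rule has_sum_finiteI[OF finite_weak_compositions])
         (auto simp: complete_symm_eq_sum sum_distrib_left norm_mult norm_power prod_norm[symmetric] intro!: sum.cong)
  qed (use assms in auto)
  hence "(\<lambda>p. ?f (snd p)) summable_on (SIGMA n:UNIV. ?C n)"
    by (rule summable_on_iff_abs_summable_on_complex[THEN iffD2])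
  then obtain T where T: "((\<lambda>p. ?f (snd p)) has_sum T) (SIGMA n:UNIV. ?C n)"
    by (auto simp: summable_on_def)
  have "((\<lambda>n. \<phi> n * complete_symm ws n) has_sum T) UNIV"
  proof (rule has_sum_SigmaD[OF T])
    show "((\<lambda>ns. ?f (snd (n, ns))) has_sum \<phi> n * complete_symm ws n) (?C n)" for n
      by (rule has_sum_finiteI[OF finite_weak_compositions])
         (auto simp: complete_symm_eq_sum sum_distrib_left intro!: sum.cong)
  qed
  hence "T = (\<Sum>\<^sub>\<infinity>n. \<phi> n * complete_symm ws n)" by (simp add: infsumI)
  with T show ?thesis using has_sum_reindex_bij_betw[OF bij, of ?f T] by simp
qed

lemma summable_on_half_powers: "(\<lambda>n. K * (1 / 2) ^ n) summable_on (UNIV :: nat set)" for K :: real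
proof (rule summable_on_cmult_right)
  show "(\<lambda>n. (1 / 2 :: real) ^ n) summable_on (UNIV :: nat set)"
    by (subst summable_on_UNIV_nonneg_real_iff) (auto intro: summable_geometric)
qed

text \<open>Both sides equal the sum of \<open>\<phi> n * complete_symm ws n\<close> over
  \<open>n\<close>: the right one by grouping exponents by degree, the left one by inserting the
  Taylor series of the symmetric polynomials and exchanging summations. A geometric bound on
  \<open>\<phi>\<close> suffices, since the polydisc may shrink with \<open>D\<close>.\<close>

lemma polylog_coeff_expansion:
  fixes \<phi> :: "nat \<Rightarrow> complex"
  assumes \<phi>: "\<And>n. norm (\<phi> n) \<le> K * D ^ n" and D: "0 < D"
  shows "\<exists>\<epsilon>>0. \<forall>xs. length xs = Suc q \<and> (\<forall>x\<in>set xs. norm x < \<epsilon>) \<longrightarrow>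
    ((\<lambda>ms. (\<Sum>n\<le>sum_list ms. of_int (polylog_coeff (rev ms) n) * \<phi> n) * exp_monom xs ms) has_sum
      (\<Sum>\<^sub>\<infinity>ns\<in>{ns. length ns = Suc q}. \<phi> (sum_list ns) * (\<Prod>j<Suc q. (1 - exp (- (suffix_sums xs ! j))) ^ (ns ! j))))
      {ms. length ms = Suc q}"
proof -
  define r where "r = Suc q"
  define M where "M = 2 * (2 * exp (real r)) ^ r"
  \<comment> \<open>Chosen so that \<open>D * 2 ^ r * \<delta> = 1 / 2\<close>, where
    \<open>2 ^ r\<close> pays for the polynomial factor in
    \<open>norm_complete_symm_le\<close>.\<close>
  define \<delta> where "\<delta> = 1 / (2 * D * 2 ^ r)"
  have M: "0 < M" and \<delta>: "0 < \<delta>" and K: "0 \<le> K"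
    using D order_trans[OF norm_ge_zero \<phi>[of 0]] by (auto simp: M_def \<delta>_def)
  have "isCont (\<lambda>z::complex. 1 - exp (- z)) 0" by (intro continuous_intros)
  then obtain \<eta> where \<eta>: "0 < \<eta>" "\<And>z::complex. norm z < \<eta> \<Longrightarrow> norm (1 - exp (- z)) < \<delta>"
    using \<delta> unfolding continuous_at_eps_delta by (metis diff_0_right exp_zero diff_self dist_norm minus_zero)
  \<comment> \<open>The bounds serve, in order, \<open>norm_polylog_coeff_series_bound\<close>, the
    ratio \<open>D * (M * \<epsilon>) \<le> 1 / 2\<close> of the double series, and the suffix sums,
    whose norms are at most \<open>r * \<epsilon> < \<eta>\<close>.\<close>
  define \<epsilon> where "\<epsilon> = min 1 (min (1 / (2 * D * M)) (\<eta> / (2 * real r)))"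
  have \<epsilon>: "0 < \<epsilon>" "\<epsilon> \<le> 1" using M D \<eta> by (auto simp: \<epsilon>_def r_def)
  have "\<epsilon> \<le> 1 / (2 * D * M)" "\<epsilon> \<le> \<eta> / (2 * real r)" by (auto simp: \<epsilon>_def)
  hence \<epsilon>2: "D * (M * \<epsilon>) \<le> 1 / 2" "real r * \<epsilon> < \<eta>"
    using M D \<eta>(1) by (auto simp: field_simps r_def)
  have "((\<lambda>ms. (\<Sum>n\<le>sum_list ms. of_int (polylog_coeff (rev ms) n) * \<phi> n) * exp_monom xs ms) has_sum
      (\<Sum>\<^sub>\<infinity>ns\<in>{ns. length ns = r}. \<phi> (sum_list ns) * (\<Prod>j<r. (1 - exp (- (suffix_sums xs ! j))) ^ (ns ! j))))
      {ms. length ms = r}"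
    if xs: "length xs = r" "\<And>x. x \<in> set xs \<Longrightarrow> norm x < \<epsilon>" for xs
  proof -
    define ws where "ws = map (\<lambda>x. 1 - exp (- x)) (suffix_sums xs)"
    have len: "length ws = r" using xs by (simp add: ws_def)
    have xs': "\<And>x. x \<in> set xs \<Longrightarrow> norm x \<le> \<epsilon>" using xs(2) by (simp add: less_imp_le)
    have "norm w \<le> \<delta>" if w: "w \<in> set ws" for w
    proof -
      obtain y where y: "y \<in> set (suffix_sums xs)" "w = 1 - exp (- y)" using w by (auto simp: ws_def)
      have "norm y \<le> real r * \<epsilon>"
        using norm_suffix_sums_le[OF xs' _ y(1)] \<epsilon> xs by simp
      thus ?thesis using \<epsilon>2 \<eta>(2)[of y] y by simp
    qed
    hence w1: "\<And>w. w \<in> set (map norm ws) \<Longrightarrow> norm w \<le> \<delta>" by auto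
    have "(\<lambda>n. norm (norm (\<phi> n) * complete_symm (map norm ws) n)) summable_on UNIV"
    proof (rule Infinite_Sum.abs_summable_on_comparison_test'[OF summable_on_half_powers[of K]])
      fix n
      have "Suc n \<le> 2 ^ n" by (induction n) auto
      hence s: "real (Suc n) \<le> 2 ^ n" by (metis of_nat_le_iff of_nat_numeral of_nat_power)
      have "norm (complete_symm (map norm ws) n) \<le> real (Suc n) ^ r * \<delta> ^ n"
        using norm_complete_symm_le[of "map norm ws" \<delta> n, OF w1 less_imp_le[OF \<delta>]] unfolding length_map len .
      also have "\<dots> \<le> (2 ^ n) ^ r * \<delta> ^ n"
        using s \<delta> by (intro mult_right_mono power_mono) auto
      finally have "norm (norm (\<phi> n) * complete_symm (map norm ws) n) \<le> (K * D ^ n) * ((2 ^ n) ^ r * \<delta> ^ n)"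
        unfolding norm_mult using \<phi>[of n] K D by (intro mult_mono) auto
      also have "((2::real) ^ n) ^ r = (2 ^ r) ^ n" by (simp only: power_mult[symmetric] mult.commute)
      also have "(K * D ^ n) * ((2 ^ r) ^ n * \<delta> ^ n) = K * (D * 2 ^ r * \<delta>) ^ n"
        by (simp add: power_mult_distrib)
      also have "D * 2 ^ r * \<delta> = 1 / 2" using D by (simp add: \<delta>_def)
      finally show "norm (norm (\<phi> n) * complete_symm (map norm ws) n) \<le> K * (1 / 2) ^ n" .
    qed
    hence "(\<lambda>n. norm (\<phi> n) * complete_symm (map norm ws) n) summable_on UNIV"
      by (rule summable_on_iff_abs_summable_on_real[THEN iffD2])
    from has_sum_compositions[OF this]
    have E: "(\<Sum>\<^sub>\<infinity>ns\<in>{ns. length ns = r}. \<phi> (sum_list ns) * (\<Prod>j<r. ws ! j ^ (ns ! j))) = (\<Sum>\<^sub>\<infinity>n. \<phi> n * complete_symm ws n)"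
      unfolding len by (rule infsumI)
    let ?L = "{ms::nat list. length ms = r}"
    define p where "p = (\<lambda>n ms. of_int (polylog_coeff (rev ms) n) * exp_monom xs ms)"
    have xs0: "xs \<noteq> []" using xs by (auto simp: r_def)
    have ps: "(p n has_sum complete_symm ws n) ?L" for n
      using has_sum_polylog_coeff[OF xs0, of n] unfolding p_def ws_def xs(1) .
    have pb: "(\<lambda>ms. norm (p n ms)) summable_on ?L" "infsum (\<lambda>ms. norm (p n ms)) ?L \<le> 2 ^ q * (M * \<epsilon>) ^ n" for n
      using norm_polylog_coeff_series_bound[where q = q and n = n and xs = xs, OF xs' less_imp_le[OF \<epsilon>(1)] \<epsilon>(2)] xs(1)
      unfolding p_def M_def r_def by simp_all
    \<comment> \<open>Absolute summability of the double family licenses the exchange: summing over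
      \<open>ms\<close> first gives the symmetric polynomials, over \<open>n\<close> first the
      finite coefficients.\<close>
    have "(\<lambda>z. norm (case z of (n, ms) \<Rightarrow> \<phi> n * p n ms)) summable_on UNIV \<times> ?L"
    proof (rule summable_on_SigmaI)
      show "((\<lambda>ms. norm (case (n, ms) of (n, ms) \<Rightarrow> \<phi> n * p n ms)) has_sum norm (\<phi> n) * infsum (\<lambda>ms. norm (p n ms)) ?L) ?L" for n
        using has_sum_cmult_right[OF has_sum_infsum[OF pb(1)[of n]]] by (simp add: norm_mult)
      have "(\<lambda>n. norm (norm (\<phi> n) * infsum (\<lambda>ms. norm (p n ms)) ?L)) summable_on UNIV"
      proof (rule Infinite_Sum.abs_summable_on_comparison_test'[OF summable_on_half_powers[of "K * 2 ^ q"]])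
        fix n
        have "norm (norm (\<phi> n) * infsum (\<lambda>ms. norm (p n ms)) ?L) \<le> (K * D ^ n) * (2 ^ q * (M * \<epsilon>) ^ n)"
          using \<phi>[of n] K D pb(2)[of n] by (simp add: abs_mult infsum_nonneg mult_mono)
        also have "\<dots> = (K * 2 ^ q) * (D * (M * \<epsilon>)) ^ n" by (simp add: power_mult_distrib)
        also have "\<dots> \<le> (K * 2 ^ q) * (1 / 2) ^ n"
          using \<epsilon>2 D M \<epsilon> K by (intro mult_left_mono power_mono) auto
        finally show "norm (norm (\<phi> n) * infsum (\<lambda>ms. norm (p n ms)) ?L) \<le> (K * 2 ^ q) * (1 / 2) ^ n" .
      qed
      thus "(\<lambda>n. norm (\<phi> n) * infsum (\<lambda>ms. norm (p n ms)) ?L) summable_on UNIV"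
        by (rule summable_on_iff_abs_summable_on_real[THEN iffD2])
    qed auto
    hence "(\<lambda>(n, ms). \<phi> n * p n ms) summable_on UNIV \<times> ?L"
      by (rule summable_on_iff_abs_summable_on_complex[THEN iffD2])
    then obtain T where T: "((\<lambda>(n, ms). \<phi> n * p n ms) has_sum T) (UNIV \<times> ?L)"
      by (auto simp: summable_on_def)
    have "((\<lambda>n. \<phi> n * complete_symm ws n) has_sum T) UNIV"
      by (rule has_sum_SigmaD[OF T]) (simp add: has_sum_cmult_right ps)
    hence T': "T = (\<Sum>\<^sub>\<infinity>n. \<phi> n * complete_symm ws n)" by (simp add: infsumI)
    have "((\<lambda>(ms, n). \<phi> n * p n ms) has_sum T) (?L \<times> UNIV)"
      using has_sum_swap[THEN iffD1, OF T] by simp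
    hence "((\<lambda>ms. (\<Sum>n\<le>sum_list ms. of_int (polylog_coeff (rev ms) n) * \<phi> n) * exp_monom xs ms) has_sum T) ?L"
    proof (rule has_sum_SigmaD)
      fix ms assume "ms \<in> ?L"
      show "((\<lambda>n. case (ms, n) of (ms, n) \<Rightarrow> \<phi> n * p n ms) has_sum
          (\<Sum>n\<le>sum_list ms. of_int (polylog_coeff (rev ms) n) * \<phi> n) * exp_monom xs ms) UNIV"
      proof (rule has_sum_finite_neutralI[of "{..sum_list ms}"])
        fix n assume "n \<in> UNIV - {..sum_list ms}"
        hence "polylog_coeff (rev ms) n = 0" by (intro polylog_coeff_eq_0) (auto simp: sum_list_rev)
        thus "(case (ms, n) of (ms, n) \<Rightarrow> \<phi> n * p n ms) = 0" by (simp add: p_def)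
      qed (auto simp: p_def sum_distrib_left sum_distrib_right mult_ac)
    qed
    moreover have "(\<Prod>j<r. (1 - exp (- (suffix_sums xs ! j))) ^ (ns ! j)) = (\<Prod>j<r. ws ! j ^ (ns ! j))" for ns :: "nat list"
      using xs by (intro prod.cong) (auto simp: ws_def)
    ultimately show ?thesis by (simp add: E T')
  qed
  with \<epsilon>(1) show ?thesis unfolding r_def by blast
qed

text \<open>The closed form in which \<open>eta\<close>, \<open>multi_poly_bernoulli\<close> and
  \<open>frakB\<close> meet. The inner sum stops at the weight because \<open>polylog_coeff\<close>
  vanishes beyond it.\<close>

definition frakB_coeff :: "complex \<Rightarrow> nat list \<Rightarrow> complex" where
  "frakB_coeff s ms = (\<Sum>a\<le>length ms - 1. (-1) ^ a * of_nat ((length ms - 1) choose a) *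
     (\<Sum>n\<le>sum_list ms. of_int (polylog_coeff (rev ms) n) * (1 / (of_nat (n + length ms) - of_nat a) powr s)))"

text \<open>\<open>a \<le> q\<close> makes the base a positive integer. The growth in
  \<open>n\<close> is at most polynomial; it is weakened to the geometric form that
  \<open>polylog_coeff_expansion\<close> takes.\<close>

lemma norm_powr_growth:
  assumes "a \<le> q"
  shows "norm (1 / (of_nat (n + Suc q) - of_nat a) powr s :: complex) \<le> 2 ^ (Suc q * nat \<lceil>\<bar>Re s\<bar>\<rceil>) * (2 ^ nat \<lceil>\<bar>Re s\<bar>\<rceil>) ^ n"
proof -
  define N where "N = n + Suc q - a"
  define p where "p = nat \<lceil>\<bar>Re s\<bar>\<rceil>"
  have N: "1 \<le> N" "of_nat (n + Suc q) - of_nat a = (of_real (real N) :: complex)"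
    using assms by (simp_all add: N_def of_nat_diff)
  have "norm (1 / (of_nat (n + Suc q) - of_nat a) powr s :: complex) = real N powr (- Re s)"
    unfolding N(2) using N(1) by (simp add: norm_divide norm_powr_real_powr powr_minus inverse_eq_divide)
  also have "\<dots> \<le> real N powr real p"
    using N by (intro powr_mono) (auto simp: p_def, linarith)
  also have "\<dots> = real N ^ p" using N by (simp add: powr_realpow)
  also have "\<dots> \<le> (2 ^ (n + Suc q)) ^ p"
  proof (intro power_mono)
    have "N \<le> n + Suc q" by (simp add: N_def)
    also have "\<dots> \<le> 2 ^ (n + Suc q)" by (rule less_imp_le[OF less_exp])
    finally show "real N \<le> 2 ^ (n + Suc q)" by (metis of_nat_le_iff of_nat_numeral of_nat_power)
  qed simp
  also have "\<dots> = 2 ^ (Suc q * p) * (2 ^ p) ^ n"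
  proof -
    have "(n + Suc q) * p = Suc q * p + p * n" by (simp add: algebra_simps)
    thus ?thesis by (simp only: power_mult[symmetric] power_add[symmetric])
  qed
  finally show ?thesis by (simp only: p_def)
qed

lemma frakB_expansion_coeff: "frakB_expansion s (Suc q) (frakB_coeff s)"
proof -
  define \<phi> where "\<phi> = (\<lambda>a n. 1 / (of_nat (n + Suc q) - of_nat a) powr s :: complex)"
  define c where "c = (\<lambda>a ms. \<Sum>n\<le>sum_list ms. of_int (polylog_coeff (rev ms) n) * \<phi> a n)"
  define E where "E = (\<lambda>a xs. \<Sum>\<^sub>\<infinity>ns\<in>{ns. length ns = Suc q}. \<phi> a (sum_list ns) * (\<Prod>j<Suc q. (1 - exp (- (suffix_sums xs ! j))) ^ (ns ! j)))"
  have "\<exists>\<epsilon>>0. \<forall>xs. length xs = Suc q \<and> (\<forall>x\<in>set xs. norm x < \<epsilon>) \<longrightarrow>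
     ((\<lambda>ms. c a ms * exp_monom xs ms) has_sum E a xs) {ms. length ms = Suc q}" if "a \<le> q" for a
    unfolding c_def E_def \<phi>_def
    by (rule polylog_coeff_expansion[where D = "2 ^ nat \<lceil>\<bar>Re s\<bar>\<rceil>"], rule norm_powr_growth[OF that]) simp
  then obtain e where e: "\<And>a. a \<le> q \<Longrightarrow> 0 < e a"
    "\<And>a xs. a \<le> q \<Longrightarrow> length xs = Suc q \<Longrightarrow> (\<And>x. x \<in> set xs \<Longrightarrow> norm x < e a) \<Longrightarrow>
      ((\<lambda>ms. c a ms * exp_monom xs ms) has_sum E a xs) {ms. length ms = Suc q}"
    by metis
  define \<epsilon> where "\<epsilon> = Min (e ` {..q})"
  have "0 < \<epsilon>" using e(1) by (simp add: \<epsilon>_def)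
  moreover have "((\<lambda>ms. frakB_coeff s ms * (\<Prod>j<Suc q. xs ! j ^ (ms ! j) / fact (ms ! j))) has_sum frakB_genfun s xs) {ms. length ms = Suc q}"
    if xs: "length xs = Suc q" "\<forall>x\<in>set xs. norm x < \<epsilon>" for xs
  proof -
    have "((\<lambda>ms. c a ms * exp_monom xs ms) has_sum E a xs) {ms. length ms = Suc q}" if "a \<le> q" for a
    proof (rule e(2)[OF that xs(1)])
      fix x assume "x \<in> set xs"
      hence "norm x < \<epsilon>" using xs by simp
      also have "\<epsilon> \<le> e a" using that by (simp add: \<epsilon>_def)
      finally show "norm x < e a" .
    qed
    hence "((\<lambda>ms. \<Sum>a\<le>q. (-1) ^ a * of_nat (q choose a) * (c a ms * exp_monom xs ms)) has_sum
       (\<Sum>a\<le>q. (-1) ^ a * of_nat (q choose a) * E a xs)) {ms. length ms = Suc q}"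
      by (intro has_sum_sum has_sum_cmult_right) auto
    also have "?this \<longleftrightarrow> ((\<lambda>ms. frakB_coeff s ms * (\<Prod>j<Suc q. xs ! j ^ (ms ! j) / fact (ms ! j))) has_sum
       (\<Sum>a\<le>q. (-1) ^ a * of_nat (q choose a) * E a xs)) {ms. length ms = Suc q}"
    proof (intro has_sum_cong)
      fix ms :: "nat list" assume "ms \<in> {ms. length ms = Suc q}"
      hence "length ms = Suc q" by simp
      thus "(\<Sum>a\<le>q. (-1) ^ a * of_nat (q choose a) * (c a ms * exp_monom xs ms)) =
          frakB_coeff s ms * (\<Prod>j<Suc q. xs ! j ^ (ms ! j) / fact (ms ! j))"
        unfolding frakB_coeff_def exp_monom_def c_def \<phi>_def xs(1)
        by (simp only: diff_Suc_1 sum_distrib_right mult.assoc)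
    qed
    also have "(\<Sum>a\<le>q. (-1) ^ a * of_nat (q choose a) * E a xs) = frakB_genfun s xs"
    proof -
      \<comment> \<open>Lowering every \<open>l_j\<close> by one makes the exponents arbitrary
        natural numbers and moves the offset \<open>Suc q\<close> into the denominator.\<close>
      have bij: "bij_betw (map Suc) {ns. length ns = Suc q} {ls. length ls = Suc q \<and> (\<forall>l\<in>set ls. 1 \<le> l)}"
        by (rule bij_betw_byWitness[where f' = "map (\<lambda>l. l - 1)"])
           (auto simp: comp_def intro!: map_idI)
      have "(\<Sum>\<^sub>\<infinity>ls\<in>{ls. length ls = Suc q \<and> (\<forall>l\<in>set ls. 1 \<le> l)}.
           (\<Prod>j<Suc q. (1 - exp (- (\<Sum>\<nu> = j..<Suc q. xs ! \<nu>))) ^ (ls ! j - 1)) /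
           (of_nat (sum_list ls) - of_nat a) powr s) = E a xs" for a
      proof -
        have "(\<Sum>\<^sub>\<infinity>ls\<in>{ls. length ls = Suc q \<and> (\<forall>l\<in>set ls. 1 \<le> l)}.
           (\<Prod>j<Suc q. (1 - exp (- (\<Sum>\<nu> = j..<Suc q. xs ! \<nu>))) ^ (ls ! j - 1)) /
           (of_nat (sum_list ls) - of_nat a) powr s) =
          (\<Sum>\<^sub>\<infinity>ns\<in>{ns. length ns = Suc q}. 
           (\<Prod>j<Suc q. (1 - exp (- (\<Sum>\<nu> = j..<Suc q. xs ! \<nu>))) ^ (map Suc ns ! j - 1)) /
           (of_nat (sum_list (map Suc ns)) - of_nat a) powr s)"
          by (rule infsum_reindex_bij_betw[OF bij, symmetric])
        also have "\<dots> = E a xs" unfolding E_def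
        proof (rule infsum_cong)
          fix ns :: "nat list" assume "ns \<in> {ns. length ns = Suc q}"
          hence ns: "length ns = Suc q" by simp
          have "sum_list (map Suc ns) = sum_list ns + Suc q"
            using ns sum_list_addf[of "\<lambda>x. x" "\<lambda>_. 1" ns] by (simp add: sum_list_triv)
          moreover have "(\<Prod>j<Suc q. (1 - exp (- (\<Sum>\<nu> = j..<Suc q. xs ! \<nu>))) ^ (map Suc ns ! j - 1)) =
              (\<Prod>j<Suc q. (1 - exp (- (suffix_sums xs ! j))) ^ (ns ! j))"
            using ns xs(1) by (intro prod.cong) (auto simp: suffix_sums_nth)
          ultimately show "(\<Prod>j<Suc q. (1 - exp (- (\<Sum>\<nu> = j..<Suc q. xs ! \<nu>))) ^ (map Suc ns ! j - 1)) /
             (of_nat (sum_list (map Suc ns)) - of_nat a) powr s =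
            \<phi> a (sum_list ns) * (\<Prod>j<Suc q. (1 - exp (- (suffix_sums xs ! j))) ^ (ns ! j))"
            by (simp only: \<phi>_def times_divide_eq_left mult_1_left)
        qed
        finally show ?thesis .
      qed
      thus ?thesis unfolding frakB_genfun_def Let_def xs(1)
        by (simp only: diff_Suc_1 atLeast0AtMost)
    qed
    finally show ?thesis .
  qed
  ultimately show ?thesis unfolding frakB_expansion_def by blast
qed

section \<open>Uniqueness of the expansion\<close>

text \<open>The hypothesis omits \<open>x = 0\<close> to fit the punctured expansion of
  \<open>multi_poly_bernoulli\<close>. The constant term is the limit at 0; after that, zeros of a
  nontrivial power series are isolated.\<close>

lemma powser_eq_0:
  fixes a :: "nat \<Rightarrow> complex"
  assumes "0 < r" and s: "\<And>x. x \<noteq> 0 \<Longrightarrow> norm x < r \<Longrightarrow> (\<lambda>n. a n * x ^ n) sums 0"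
  shows "a m = 0"
proof (rule ccontr)
  assume m: "a m \<noteq> 0"
  have "((\<lambda>_. 0) \<longlongrightarrow> a 0) (at (0::complex))"
    by (rule powser_limit_0_strong[OF assms(1)]) (rule s)
  hence a0: "a 0 = 0" by (simp add: tendsto_const_iff)
  hence "m > 0" using m by (cases m) auto
  have "(\<lambda>n. a n * (x - 0) ^ n) sums 0" if "norm (x - 0) < r" for x
    using s[of x] that a0 powser_sums_zero[of a] by (cases "x = 0") auto
  note sums = this
  show False
  proof (rule powser_0_nonzero[where f = "\<lambda>_. 0" and \<xi> = 0 and a = a and m = m, OF assms(1) sums refl m \<open>m > 0\<close>])
    fix e :: real
    assume "0 < e" "\<And>z::complex. z \<in> cball 0 e - {0} \<Longrightarrow> (0::complex) \<noteq> 0"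
    from this(2)[of "of_real e"] this(1) show False by simp
  qed
qed

text \<open>With the other variables fixed, the family is a power series in the first one, and each
  of its coefficients is a series of the same kind in one variable less.\<close>

lemma exp_series_eq_0:
  assumes "0 < \<epsilon>"
    and "\<And>xs. length xs = r \<Longrightarrow> (\<And>x. x \<in> set xs \<Longrightarrow> norm x < \<epsilon>) \<Longrightarrow>
       ((\<lambda>ms. c ms * exp_monom xs ms) has_sum 0) {ms. length ms = r}"
    and "length ms = r"
  shows "c ms = 0"
  using assms(2,3)
proof (induction r arbitrary: c ms)
  case 0
  have "{ms::nat list. length ms = 0} = {[]}" by auto
  with 0(1)[of "[]"] have "((\<lambda>ms. c ms) has_sum 0) {[]}" by simp
  moreover have "(c has_sum c []) {[]}" by (rule has_sum_finiteI) auto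
  ultimately have "c [] = 0" by (rule has_sum_unique[rotated])
  thus ?case using 0(2) by simp
next
  case (Suc r)
  let ?L = "{ms::nat list. length ms = r}"
  obtain m0 ms' where ms: "ms = m0 # ms'" "length ms' = r" using Suc.prems(2) by (auto simp: length_Suc_conv)
  have bij: "bij_betw (\<lambda>(m, ms). m # ms) (UNIV \<times> ?L) {ms. length ms = Suc r}"
    by (rule bij_betw_byWitness[where f' = "\<lambda>ms. (hd ms, tl ms)"]) (auto simp: length_Suc_conv)
  show ?case unfolding ms(1)
  proof (rule Suc.IH[of "\<lambda>ms. c (m0 # ms)", OF _ ms(2)])
    fix xs :: "complex list"
    assume xs: "length xs = r" "\<And>x. x \<in> set xs \<Longrightarrow> norm x < \<epsilon>"
    have tot: "((\<lambda>(m, ms). x ^ m / fact m * (c (m # ms) * exp_monom xs ms)) has_sum 0) (UNIV \<times> ?L)" if "norm x < \<epsilon>" for x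
    proof -
      have "((\<lambda>ms. c ms * exp_monom (x # xs) ms) has_sum 0) {ms. length ms = Suc r}"
        using xs that by (intro Suc.prems(1)) auto
      hence "((\<lambda>p. c ((\<lambda>(m, ms). m # ms) p) * exp_monom (x # xs) ((\<lambda>(m, ms). m # ms) p)) has_sum 0) (UNIV \<times> ?L)"
        by (rule has_sum_reindex_bij_betw[OF bij, of "\<lambda>ms. c ms * exp_monom (x # xs) ms" 0, THEN iffD2])
      thus ?thesis by (rule has_sum_cong[THEN iffD1, rotated]) (auto simp: exp_monom_Cons mult_ac)
    qed
    have sm: "(\<lambda>ms. c (m # ms) * exp_monom xs ms) summable_on ?L" for m
    proof -
      \<comment> \<open>Any nonzero point of the disc would do: a slice of the total sum carries the
        factor \<open>x ^ m / fact m\<close>, which has to be divided out.\<close>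
      define x where "x = (of_real (\<epsilon> / 2) :: complex)"
      have x: "norm x < \<epsilon>" "x \<noteq> 0" using assms(1) by (auto simp: x_def)
      have "(\<lambda>ms. x ^ m / fact m * (c (m # ms) * exp_monom xs ms)) summable_on ?L"
        using summable_on_SigmaD1[OF has_sum_imp_summable[OF tot[OF x(1)]], of m] by simp
      from summable_on_cmult_right[OF this, of "fact m / x ^ m"] show ?thesis
        using x(2) by (simp add: field_simps)
    qed
    define d where "d = (\<lambda>m. infsum (\<lambda>ms. c (m # ms) * exp_monom xs ms) ?L)"
    have "(\<lambda>m. d m / fact m * x ^ m) sums 0" if "norm x < \<epsilon>" for x
    proof (rule has_sum_imp_sums, rule has_sum_SigmaD[OF tot[OF that]])
      fix m
      show "((\<lambda>ms. case (m, ms) of (m, ms) \<Rightarrow> x ^ m / fact m * (c (m # ms) * exp_monom xs ms)) has_sum d m / fact m * x ^ m) ?L"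
        using has_sum_cmult_right[OF has_sum_infsum[OF sm[of m]], of "x ^ m / fact m"]
        by (simp add: d_def mult_ac)
    qed
    hence "d m0 / fact m0 = 0" using powser_eq_0[OF assms(1), of "\<lambda>m. d m / fact m" m0] by simp
    thus "((\<lambda>ms. c (m0 # ms) * exp_monom xs ms) has_sum 0) ?L"
      using has_sum_infsum[OF sm[of m0]] by (simp add: d_def)
  qed
qed

lemma has_sum_diff:
  fixes f g :: "'a \<Rightarrow> 'b::{topological_ab_group_add}"
  assumes "(f has_sum a) A" "(g has_sum b) A"
  shows "((\<lambda>x. f x - g x) has_sum (a - b)) A"
proof -
  have "((\<lambda>x. - g x) has_sum - b) A" using assms(2) by (simp add: has_sum_uminus)
  from has_sum_add[OF assms(1) this] show ?thesis by simp
qed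

lemma frakB_expansion_unique:
  assumes "frakB_expansion s r c" "frakB_expansion s r c'" "length ms = r"
  shows "c ms = c' ms"
proof -
  from assms(1) obtain e1 where e1: "0 < e1" "\<And>xs. length xs = r \<and> (\<forall>x\<in>set xs. norm x < e1) \<Longrightarrow>
      ((\<lambda>ms. c ms * (\<Prod>j<r. xs ! j ^ (ms ! j) / fact (ms ! j))) has_sum frakB_genfun s xs) {ms. length ms = r}"
    unfolding frakB_expansion_def by blast
  from assms(2) obtain e2 where e2: "0 < e2" "\<And>xs. length xs = r \<and> (\<forall>x\<in>set xs. norm x < e2) \<Longrightarrow>
      ((\<lambda>ms. c' ms * (\<Prod>j<r. xs ! j ^ (ms ! j) / fact (ms ! j))) has_sum frakB_genfun s xs) {ms. length ms = r}"
    unfolding frakB_expansion_def by blast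
  have "c ms - c' ms = 0"
  proof (rule exp_series_eq_0[where \<epsilon> = "min e1 e2" and c = "\<lambda>ms. c ms - c' ms", OF _ _ assms(3)])
    fix xs :: "complex list"
    assume xs: "length xs = r" "\<And>x. x \<in> set xs \<Longrightarrow> norm x < min e1 e2"
    have "((\<lambda>ms. c ms * exp_monom xs ms - c' ms * exp_monom xs ms) has_sum frakB_genfun s xs - frakB_genfun s xs) {ms. length ms = r}"
      unfolding exp_monom_def xs(1) by (intro has_sum_diff e1(2) e2(2)) (use xs in auto)
    thus "((\<lambda>ms. (c ms - c' ms) * exp_monom xs ms) has_sum 0) {ms. length ms = r}"
      by (simp add: left_diff_distrib)
  qed (use e1(1) e2(1) in auto)
  thus ?thesis by simp
qed

lemma frakB_eq:
  assumes "ms \<noteq> []"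
  shows "frakB s ms = frakB_coeff s ms"
proof -
  obtain q where q: "length ms = Suc q" using assms by (cases ms) auto
  show ?thesis unfolding frakB_def q
  proof (rule the_equality)
    show "\<exists>c. frakB_expansion s (Suc q) c \<and> frakB_coeff s ms = c ms"
      using frakB_expansion_coeff by blast
  qed (use frakB_expansion_unique[OF _ frakB_expansion_coeff q] in blast)
qed

section \<open>The polylogarithm as a rational function\<close>

lemma sums_negative_binomial:
  fixes z :: complex
  assumes "norm z < 1"
  shows "(\<lambda>j. of_nat ((j + p) choose p) * z ^ j) sums (1 / (1 - z) ^ Suc p)"
proof -
  have "(\<lambda>j. (- of_nat (Suc p) gchoose j) * (- z) ^ j) sums (1 + - z) powr (- of_nat (Suc p))"
    using assms by (intro gen_binomial_complex) simp
  moreover have "(- of_nat (Suc p) gchoose j) * (- z) ^ j = of_nat ((j + p) choose p) * z ^ j" for j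
  proof -
    have "(- of_nat (Suc p) gchoose j) = (-1) ^ j * ((of_nat (p + j) :: complex) gchoose j)"
      unfolding gbinomial_minus by simp
    also have "(of_nat (p + j) :: complex) gchoose j = of_nat ((p + j) choose j)"
      by (rule binomial_gbinomial[symmetric])
    also have "(p + j) choose j = (j + p) choose p"
      using binomial_symmetric[of j "p + j"] by (simp add: add.commute)
    finally show ?thesis by (simp add: power_minus[of z])
  qed
  moreover have "(1 + - z) powr (- of_nat (Suc p)) = 1 / (1 - z) ^ Suc p"
  proof -
    have "1 - z \<noteq> 0" using assms by auto
    hence "(1 - z) powr (of_nat (Suc p)) = (1 - z) ^ Suc p" by (intro powr_nat') simp
    thus ?thesis by (simp only: powr_minus add_uminus_conv_diff inverse_eq_divide)
  qed
  ultimately show ?thesis by simp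
qed

lemma has_sum_negative_binomial:
  fixes z :: complex
  assumes "norm z < 1"
  shows "((\<lambda>j. of_nat ((j + p) choose p) * z ^ j) has_sum (1 / (1 - z) ^ Suc p)) UNIV"
proof (rule norm_summable_imp_has_sum[OF _ sums_negative_binomial[OF assms]])
  \<comment> \<open>The coefficients are nonnegative, so the same expansion at \<open>norm z\<close>
    supplies absolute convergence.\<close>
  have "summable (\<lambda>j. complex_of_real (real ((j + p) choose p) * norm z ^ j))"
    using sums_summable[OF sums_negative_binomial[of "of_real (norm z)" p]] assms by simp
  thus "summable (\<lambda>j. norm (of_nat ((j + p) choose p) * z ^ j))"
    unfolding summable_of_real_iff by (simp add: norm_mult norm_power)
qed

text \<open>The coefficients with \<open>i < q\<close> vanish, so the series shifted by
  \<open>q\<close> may run over all natural numbers.\<close>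

lemma has_sum_shifted_negative_binomial:
  fixes z :: complex
  assumes "norm z < 1"
  shows "((\<lambda>i. of_nat ((i + n) choose (n + q)) * z ^ i) has_sum (z ^ q / (1 - z) ^ Suc (n + q))) UNIV"
proof -
  have bij: "bij_betw (\<lambda>j. j + q) UNIV {q..}"
    by (rule bij_betw_byWitness[where f' = "\<lambda>i. i - q"]) auto
  have "((\<lambda>j. z ^ q * (of_nat ((j + (n + q)) choose (n + q)) * z ^ j)) has_sum (z ^ q * (1 / (1 - z) ^ Suc (n + q)))) UNIV"
    by (rule has_sum_cmult_right[OF has_sum_negative_binomial[OF assms]])
  hence "((\<lambda>j. of_nat (((j + q) + n) choose (n + q)) * z ^ (j + q)) has_sum (z ^ q / (1 - z) ^ Suc (n + q))) UNIV"
    by (simp add: power_add mult_ac add_ac)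
  hence "((\<lambda>i. of_nat ((i + n) choose (n + q)) * z ^ i) has_sum (z ^ q / (1 - z) ^ Suc (n + q))) {q..}"
    using has_sum_reindex_bij_betw[OF bij, of "\<lambda>i. of_nat ((i + n) choose (n + q)) * z ^ i"] by simp
  thus ?thesis
    by (rule has_sum_cong_neutral[THEN iffD1, rotated -1]) (auto simp: binomial_eq_0)
qed

section \<open>Strictly increasing lists and the summation of the polylogarithm\<close>

definition increasing_lists :: "nat \<Rightarrow> nat list set" where
  "increasing_lists r = {ms. length ms = r \<and> sorted_wrt (<) ms \<and> (\<forall>m\<in>set ms. 1 \<le> m)}"

text \<open>Prefixing 0 makes the fibre of the empty list well defined.\<close>

definition increasing_to :: "nat \<Rightarrow> nat \<Rightarrow> nat list set" where
  "increasing_to r m = {ms \<in> increasing_lists r. last (0 # ms) = m}"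

lemma increasing_to_0: "increasing_to 0 m = (if m = 0 then {[]} else {})"
  by (auto simp: increasing_to_def increasing_lists_def)

lemma sorted_wrt_le_last: "sorted_wrt (<) ms \<Longrightarrow> x \<in> set ms \<Longrightarrow> x \<le> last (0 # ms)" for ms :: "nat list"
  by (induction ms rule: rev_induct) (auto simp: sorted_wrt_append less_imp_le)

lemma bij_betw_increasing_to:
  "bij_betw (\<lambda>(i, ms). ms @ [m]) (SIGMA i:{..<m}. increasing_to r i) (increasing_to (Suc r) m)"
proof (rule bij_betw_byWitness[where f' = "\<lambda>ms. (last (0 # butlast ms), butlast ms)"])
  show "(\<lambda>(i, ms). ms @ [m]) ` (SIGMA i:{..<m}. increasing_to r i) \<subseteq> increasing_to (Suc r) m"
  proof (rule image_subsetI)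
    fix p assume "p \<in> (SIGMA i:{..<m}. increasing_to r i)"
    then obtain i ms where p: "p = (i, ms)" and i: "i < m" and ms: "ms \<in> increasing_to r i" by auto
    hence "x < m" if "x \<in> set ms" for x
      using sorted_wrt_le_last[of ms x] that by (auto simp: increasing_to_def increasing_lists_def)
    with i ms show "(case p of (i, ms) \<Rightarrow> ms @ [m]) \<in> increasing_to (Suc r) m"
      by (auto simp: p increasing_to_def increasing_lists_def sorted_wrt_append)
  qed
  show "(\<lambda>ms. (last (0 # butlast ms), butlast ms)) ` increasing_to (Suc r) m \<subseteq> (SIGMA i:{..<m}. increasing_to r i)"
  proof (rule image_subsetI)
    fix ms assume ms: "ms \<in> increasing_to (Suc r) m"
    then obtain ns where ns: "ms = ns @ [m]"
      by (cases ms rule: rev_cases) (auto simp: increasing_to_def increasing_lists_def)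
    have "last (0 # ns) < m"
      using ms unfolding ns by (auto simp: increasing_to_def increasing_lists_def sorted_wrt_append)
    thus "(last (0 # butlast ms), butlast ms) \<in> (SIGMA i:{..<m}. increasing_to r i)"
      using ms unfolding ns by (auto simp: increasing_to_def increasing_lists_def sorted_wrt_append)
  qed
  show "\<forall>ms\<in>increasing_to (Suc r) m. (case (last (0 # butlast ms), butlast ms) of (i, ms) \<Rightarrow> ms @ [m]) = ms"
    by (auto simp: increasing_to_def increasing_lists_def append_butlast_last_id split: if_splits)
qed (auto simp: increasing_to_def)

lemma finite_increasing_to: "finite (increasing_to r m)"
proof (induction r arbitrary: m)
  case (Suc r)
  then show ?case using bij_betw_finite[OF bij_betw_increasing_to[of m r]] by auto
qed (simp add: increasing_to_0)

lemma strict_sum_eq_sum: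
  "strict_sum (rev ks) m = (\<Sum>ms\<in>increasing_to (length ks) m. \<Prod>j<length ks. (ms ! j) ^ (ks ! j))"
proof (induction ks arbitrary: m rule: rev_induct)
  case Nil
  then show ?case by (simp add: increasing_to_0)
next
  case (snoc k ks)
  let ?P = "\<lambda>ms. \<Prod>j<length ks. (ms ! j) ^ (ks ! j)"
  have "strict_sum (rev (ks @ [k])) m = (\<Sum>i<m. \<Sum>ms\<in>increasing_to (length ks) i. m ^ k * ?P ms)"
    by (simp add: snoc sum_distrib_left)
  also have "\<dots> = (\<Sum>(i, ms)\<in>(SIGMA i:{..<m}. increasing_to (length ks) i). m ^ k * ?P ms)"
    by (rule sum.Sigma) (auto simp: finite_increasing_to)
  also have "\<dots> = (\<Sum>p\<in>(SIGMA i:{..<m}. increasing_to (length ks) i).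
      \<Prod>j<length (ks @ [k]). ((\<lambda>(i, ms). ms @ [m]) p ! j) ^ ((ks @ [k]) ! j))"
  proof (rule sum.cong[OF refl])
    fix p assume "p \<in> (SIGMA i:{..<m}. increasing_to (length ks) i)"
    then obtain i ms where p: "p = (i, ms)" "ms \<in> increasing_to (length ks) i" by auto
    hence "length ms = length ks" by (simp add: increasing_to_def increasing_lists_def)
    thus "(case p of (i, ms) \<Rightarrow> m ^ k * ?P ms) = (\<Prod>j<length (ks @ [k]). ((case p of (i, ms) \<Rightarrow> ms @ [m]) ! j) ^ ((ks @ [k]) ! j))"
      by (simp add: p(1) nth_append)
  qed
  also have "\<dots> = (\<Sum>ms\<in>increasing_to (Suc (length ks)) m. \<Prod>j<length (ks @ [k]). (ms ! j) ^ ((ks @ [k]) ! j))"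
    by (rule sum.reindex_bij_betw[OF bij_betw_increasing_to])
  finally show ?case by simp
qed

definition polylog_value :: "nat list \<Rightarrow> complex \<Rightarrow> complex" where
  "polylog_value ks z = z ^ length ks * (\<Sum>n\<le>sum_list ks. of_int (polylog_coeff (rev ks) n) / (1 - z) ^ (n + length ks))"

lemma has_sum_strict_sum:
  assumes "ks \<noteq> []" "norm z < 1"
  shows "((\<lambda>m. of_nat (strict_sum (rev ks) m) * z ^ m) has_sum polylog_value ks z) UNIV"
proof -
  obtain k ks' where ks: "rev ks = k # ks'" using assms by (cases "rev ks") auto
  define q where "q = length ks'"
  have q: "length ks = Suc q" using arg_cong[OF ks, of length] by (simp add: q_def)
  let ?B = "sum_list ks"
  have "((\<lambda>i. z * (\<Sum>n\<le>?B. of_int (polylog_coeff (rev ks) n) * (of_nat ((i + n) choose (n + q)) * z ^ i))) has_sum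
     z * (\<Sum>n\<le>?B. of_int (polylog_coeff (rev ks) n) * (z ^ q / (1 - z) ^ Suc (n + q)))) UNIV"
    by (intro has_sum_sum has_sum_cmult_right has_sum_shifted_negative_binomial assms) auto
  also have "z * (\<Sum>n\<le>?B. of_int (polylog_coeff (rev ks) n) * (z ^ q / (1 - z) ^ Suc (n + q))) = polylog_value ks z"
    unfolding polylog_value_def q by (simp add: sum_distrib_left mult_ac)
  also have "(\<lambda>i. z * (\<Sum>n\<le>?B. of_int (polylog_coeff (rev ks) n) * (of_nat ((i + n) choose (n + q)) * z ^ i)))
     = (\<lambda>i. of_nat (strict_sum (rev ks) (Suc i)) * z ^ Suc i)"
  proof
    fix i
    have "of_nat (strict_sum (rev ks) (Suc i)) = (of_int (int (strict_sum (rev ks) (Suc i))) :: complex)" by simp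
    also have "\<dots> = (\<Sum>n\<le>?B. of_int (polylog_coeff (rev ks) n) * of_nat ((i + n) choose (n + q)))"
      by (subst strict_sum_eq[OF ks, of ?B]) (simp_all add: q_def sum_list_rev)
    finally show "z * (\<Sum>n\<le>?B. of_int (polylog_coeff (rev ks) n) * (of_nat ((i + n) choose (n + q)) * z ^ i)) = of_nat (strict_sum (rev ks) (Suc i)) * z ^ Suc i"
      by (simp add: sum_distrib_left sum_distrib_right mult_ac)
  qed
  finally have "((\<lambda>i. of_nat (strict_sum (rev ks) (Suc i)) * z ^ Suc i) has_sum polylog_value ks z) UNIV" .
  hence "((\<lambda>m. of_nat (strict_sum (rev ks) m) * z ^ m) has_sum polylog_value ks z) (range Suc)"
    by (subst has_sum_reindex) (simp_all add: comp_def)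
  thus ?thesis
  proof (rule has_sum_cong_neutral[THEN iffD1, rotated -1])
    fix m assume "m \<in> UNIV - range Suc"
    hence "m = 0" using not0_implies_Suc by auto
    thus "of_nat (strict_sum (rev ks) m) * z ^ m = 0" by (simp add: ks)
  qed auto
qed

text \<open>Tuples are grouped by their last entry. Undoing the grouping requires absolute
  summability, which comes from the grouped series at \<open>norm z\<close>.\<close>

lemma multi_polylog_eq:
  assumes "ks \<noteq> []" "norm z < 1"
  shows "multi_polylog (map (\<lambda>k. - int k) ks) z = polylog_value ks z"
proof -
  define r where "r = length ks"
  let ?P = "\<lambda>ms. \<Prod>j<r. (ms ! j) ^ (ks ! j)"
  let ?f = "\<lambda>ms. of_nat (?P ms) * z ^ last (0 # ms)"
  have bij: "bij_betw snd (SIGMA m:UNIV. increasing_to r m) (increasing_lists r)"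
    by (rule bij_betw_byWitness[where f' = "\<lambda>ms. (last (0 # ms), ms)"]) (auto simp: increasing_to_def)
  \<comment> \<open>Stated over a general normed field because it is used over the reals for the
    norms and over the complex numbers for the values.\<close>
  have fib: "((\<lambda>ms. of_nat (?P ms) * w ^ last (0 # ms)) has_sum of_nat (strict_sum (rev ks) m) * w ^ m) (increasing_to r m)"
    for m and w :: "'a::{real_normed_field}"
    unfolding strict_sum_eq_sum r_def[symmetric]
    by (rule has_sum_finiteI[OF finite_increasing_to])
       (auto simp: sum_distrib_right increasing_to_def intro!: sum.cong simp del: last.simps of_nat_prod)
  have "(\<lambda>p. norm (?f (snd p))) summable_on (SIGMA m:UNIV. increasing_to r m)"
  proof (rule summable_on_SigmaI)
    show "((\<lambda>ms. norm (?f (snd (m, ms)))) has_sum real (strict_sum (rev ks) m) * norm z ^ m) (increasing_to r m)" for m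
      using fib[of "norm z" m] by (simp add: norm_mult norm_power del: last.simps of_nat_prod)
    have "(\<lambda>m. complex_of_real (real (strict_sum (rev ks) m) * norm z ^ m)) summable_on UNIV"
      using has_sum_imp_summable[OF has_sum_strict_sum[OF assms(1), of "of_real (norm z)"]] assms(2) by simp
    from summable_on_Re[OF this] show "(\<lambda>m. real (strict_sum (rev ks) m) * norm z ^ m) summable_on UNIV"
      by (simp only: Re_complex_of_real)
  qed (auto simp del: last.simps)
  hence "(\<lambda>p. ?f (snd p)) summable_on (SIGMA m:UNIV. increasing_to r m)"
    by (rule summable_on_iff_abs_summable_on_complex[THEN iffD2])
  then obtain T where T: "((\<lambda>p. ?f (snd p)) has_sum T) (SIGMA m:UNIV. increasing_to r m)"
    by (auto simp: summable_on_def)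
  have "((\<lambda>m. of_nat (strict_sum (rev ks) m) * z ^ m) has_sum T) UNIV"
    by (rule has_sum_SigmaD[OF T]) (use fib[of z] in simp)
  hence "T = polylog_value ks z" using has_sum_strict_sum[OF assms] has_sum_unique by blast
  with T have hs: "(?f has_sum polylog_value ks z) (increasing_lists r)"
    using has_sum_reindex_bij_betw[OF bij, of ?f T] by simp
  have "multi_polylog (map (\<lambda>k. - int k) ks) z = infsum ?f (increasing_lists r)"
    unfolding multi_polylog_def increasing_lists_def length_map r_def
  proof (rule infsum_cong)
    fix ms :: "nat list" assume "ms \<in> {ms. length ms = length ks \<and> sorted_wrt (<) ms \<and> (\<forall>m\<in>set ms. 1 \<le> m)}"
    hence "ms \<noteq> []" using assms(1) by auto
    moreover have "(\<Prod>j<length ks. of_nat (ms ! j) powi (map (\<lambda>k. - int k) ks ! j)) = inverse (\<Prod>j<length ks. complex_of_nat (ms ! j) ^ (ks ! j))"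
      unfolding prod_inversef[symmetric] comp_def
      by (intro prod.cong) (auto simp: power_int_minus power_int_of_nat)
    ultimately show "z ^ last ms / (\<Prod>j<length ks. of_nat (ms ! j) powi (map (\<lambda>k. - int k) ks ! j)) =
       of_nat (\<Prod>j<length ks. (ms ! j) ^ (ks ! j)) * z ^ last (0 # ms)"
      by (simp add: divide_inverse mult.commute)
  qed
  also have "\<dots> = polylog_value ks z" using hs by (rule infsumI)
  finally show ?thesis .
qed

lemma multi_polylog_rat_eq:
  assumes "ks \<noteq> []" "z \<noteq> 1"
  shows "multi_polylog_rat (map (\<lambda>k. - int k) ks) z = polylog_value ks z"
proof -
  define r where "r = length ks"
  define B where "B = sum_list ks"
  let ?ks = "map (\<lambda>k. - int k) ks"
  define P :: "complex poly" where "P = monom 1 r * (\<Sum>n\<le>B. smult (of_int (polylog_coeff (rev ks) n)) ([:1, -1:] ^ (B - n)))"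
  have P: "polylog_value ks u = poly P u / (1 - u) ^ (B + r)" if "u \<noteq> 1" for u
  proof -
    have "poly P u / (1 - u) ^ (B + r) = u ^ r * (\<Sum>n\<le>B. of_int (polylog_coeff (rev ks) n) * ((1 - u) ^ (B - n) / (1 - u) ^ (B + r)))"
      by (simp add: P_def poly_monom poly_sum sum_divide_distrib sum_distrib_left mult_ac)
    also have "\<dots> = polylog_value ks u"
      unfolding polylog_value_def r_def[symmetric] B_def[symmetric]
    proof (intro arg_cong2[where f = times] sum.cong refl)
      fix n assume "n \<in> {..B}"
      hence "(1 - u) ^ (B + r) = (1 - u) ^ (B - n) * (1 - u) ^ (n + r)"
        by (simp flip: power_add)
      thus "of_int (polylog_coeff (rev ks) n) * ((1 - u) ^ (B - n) / (1 - u) ^ (B + r)) = of_int (polylog_coeff (rev ks) n) / (1 - u) ^ (n + r)"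
        using that by simp
    qed
    finally show ?thesis by simp
  qed
  have Pd: "multi_polylog ?ks u = poly P u / (1 - u) ^ (B + r)" if "norm u < 1" for u
  proof -
    have "u \<noteq> 1" using that by auto
    thus ?thesis using multi_polylog_eq[OF assms(1) that] P by simp
  qed
  show ?thesis unfolding multi_polylog_rat_def
  proof (rule the_equality)
    show "\<exists>p n. (\<forall>u. norm u < 1 \<longrightarrow> multi_polylog ?ks u = poly p u / (1 - u) ^ n) \<and> polylog_value ks z = poly p z / (1 - z) ^ n"
      using Pd P[OF assms(2)] by blast
    fix w assume "\<exists>p n. (\<forall>u. norm u < 1 \<longrightarrow> multi_polylog ?ks u = poly p u / (1 - u) ^ n) \<and> w = poly p z / (1 - z) ^ n"
    then obtain p n where p: "\<And>u. norm u < 1 \<Longrightarrow> multi_polylog ?ks u = poly p u / (1 - u) ^ n" "w = poly p z / (1 - z) ^ n"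
      by blast
    \<comment> \<open>After cross-multiplication two representations agree on the unit disc, an
      infinite set, hence as polynomials; this transports the value to points outside the
      disc.\<close>
    have "p * [:1, -1:] ^ (B + r) - P * [:1, -1:] ^ n = 0"
    proof (rule ccontr)
      assume "p * [:1, -1:] ^ (B + r) - P * [:1, -1:] ^ n \<noteq> 0"
      hence "finite {u. poly (p * [:1, -1:] ^ (B + r) - P * [:1, -1:] ^ n) u = 0}"
        by (rule poly_roots_finite)
      moreover have "ball 0 1 \<subseteq> {u. poly (p * [:1, -1:] ^ (B + r) - P * [:1, -1:] ^ n) u = 0}"
      proof safe
        fix u :: complex assume "u \<in> ball 0 1"
        hence u: "norm u < 1" by simp
        hence "1 - u \<noteq> 0" by auto
        with p(1)[OF u] Pd[OF u] show "poly (p * [:1, -1:] ^ (B + r) - P * [:1, -1:] ^ n) u = 0"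
          by (simp add: frac_eq_eq)
      qed
      ultimately have "finite (ball (0::complex) 1)" using finite_subset by blast
      thus False using uncountable_ball[of 1 "0::complex"] countable_finite by auto
    qed
    hence "poly (p * [:1, -1:] ^ (B + r) - P * [:1, -1:] ^ n) z = 0" by simp
    hence "poly p z * (1 - z) ^ (B + r) = poly P z * (1 - z) ^ n" by simp
    thus "w = polylog_value ks z"
      using assms(2) by (simp add: p(2) P[OF assms(2)] frac_eq_eq)
  qed
qed

section \<open>The common closed form\<close>

text \<open>Replacing \<open>a\<close> by \<open>q - a\<close> reconciles the bases
  \<open>n + q + 1 - a\<close> and \<open>n + 1 + a\<close>. The resulting sign
  \<open>(-1) ^ q\<close> is that of \<open>(1 - exp t) ^ q\<close> for
  \<open>t > 0\<close>.\<close>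

lemma frakB_coeff_alt:
  assumes "length ks = Suc q"
  shows "frakB_coeff s ks = (\<Sum>n\<le>sum_list ks. (-1) ^ q * of_int (polylog_coeff (rev ks) n) * mellin_value q s (real n + 1))"
proof -
  have "(\<Sum>n\<le>sum_list ks. (-1) ^ q * of_int (polylog_coeff (rev ks) n) * mellin_value q s (real n + 1))
    = (\<Sum>n\<le>sum_list ks. \<Sum>a\<le>q. (-1) ^ a * of_nat (q choose a) * (of_int (polylog_coeff (rev ks) n) * (1 / (of_nat (n + Suc q) - of_nat a) powr s)))"
  proof (rule sum.cong[OF refl])
    fix n
    have "mellin_value q s (real n + 1) = (\<Sum>a\<le>q. (-1) ^ (q - a) * of_nat (q choose (q - a)) * of_real (real n + 1 + real (q - a)) powr (- s))"
      unfolding mellin_value_def by (rule sum.reindex_bij_witness[where i = "\<lambda>a. q - a" and j = "\<lambda>a. q - a"]) auto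
    also have "\<dots> = (\<Sum>a\<le>q. (-1) ^ q * ((-1) ^ a * of_nat (q choose a)) * (1 / (of_nat (n + Suc q) - of_nat a) powr s))"
    proof (rule sum.cong[OF refl])
      fix a assume "a \<in> {..q}"
      hence a: "a \<le> q" by simp
      have "(-1) ^ (q - a) = ((-1) ^ q * (-1) ^ a :: complex)"
        using a by (simp add: minus_one_power_iff)
      moreover have "q choose (q - a) = q choose a" using a by (rule binomial_symmetric[symmetric])
      moreover have "complex_of_real (real n + 1 + real (q - a)) = of_nat (n + Suc q) - of_nat a"
        using a by (simp add: of_nat_diff)
      ultimately show "(-1) ^ (q - a) * of_nat (q choose (q - a)) * of_real (real n + 1 + real (q - a)) powr (- s)
         = (-1) ^ q * ((-1) ^ a * of_nat (q choose a)) * (1 / (of_nat (n + Suc q) - of_nat a :: complex) powr s)"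
        by (simp only: powr_minus inverse_eq_divide mult.assoc)
    qed
    finally have m: "mellin_value q s (real n + 1) = (-1) ^ q * (\<Sum>a\<le>q. (-1) ^ a * of_nat (q choose a) * (1 / (of_nat (n + Suc q) - of_nat a) powr s))"
      by (simp only: sum_distrib_left mult.assoc)
    have "(-1) ^ q * ((-1) ^ q :: complex) = 1" by (simp flip: power_mult_distrib)
    hence "(-1) ^ q * of_int (polylog_coeff (rev ks) n) * mellin_value q s (real n + 1) =
      of_int (polylog_coeff (rev ks) n) * (\<Sum>a\<le>q. (-1) ^ a * of_nat (q choose a) * (1 / (of_nat (n + Suc q) - of_nat a) powr s))"
      unfolding m by (metis (no_types, lifting) mult.assoc mult.commute mult_1)
    thus "(-1) ^ q * of_int (polylog_coeff (rev ks) n) * mellin_value q s (real n + 1) =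
       (\<Sum>a\<le>q. (-1) ^ a * of_nat (q choose a) * (of_int (polylog_coeff (rev ks) n) * (1 / (of_nat (n + Suc q) - of_nat a) powr s)))"
      by (simp only: sum_distrib_left mult.left_commute)
  qed
  also have "\<dots> = frakB_coeff s ks"
    unfolding frakB_coeff_def assms diff_Suc_1 by (subst sum.swap) (simp only: sum_distrib_left)
  finally show ?thesis by simp
qed

text \<open>Serves twice: at a nonzero base \<open>powr\<close> is entire and without zeros in the
  exponent, and it agrees with the ordinary power even for the exponent 0, whereas
  \<open>0 powr 0 = 0\<close>.\<close>

lemma shift_nonzero: "a \<le> q \<Longrightarrow> of_nat (n + Suc q) - of_nat a \<noteq> (0 :: complex)"
  by (metis eq_iff_diff_eq_0 le_add2 le_trans not_less_eq_eq of_nat_eq_iff)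

lemma frakB_coeff_holomorphic:
  assumes "length ks = Suc q"
  shows "(\<lambda>s. frakB_coeff s ks) holomorphic_on UNIV"
  unfolding frakB_coeff_def assms diff_Suc_1
  by (intro holomorphic_intros) (use shift_nonzero in \<open>auto simp del: of_nat_add of_nat_Suc\<close>)

lemma polylog_value_divide:
  assumes "length ks = Suc q" "z \<noteq> 0"
  shows "polylog_value ks z / z = (\<Sum>n\<le>sum_list ks. of_int (polylog_coeff (rev ks) n) * (z ^ q / (1 - z) ^ (n + Suc q)))"
  unfolding polylog_value_def assms(1) using assms(2)
  by (simp add: sum_distrib_left sum_divide_distrib mult_ac)

text \<open>Pulling \<open>exp t ^ q\<close> out of \<open>(1 - exp t) ^ q\<close> leaves the zero
  of order \<open>q\<close> at 0 and the decay \<open>exp (- (n + 1) t)\<close>; hence the kernel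
  parameter \<open>real n + 1\<close>, which is always positive.\<close>

lemma polylog_value_integrand:
  assumes "length ks = Suc q" "0 < t"
  shows "of_real t powr (s - 1) * (polylog_value ks (of_real (1 - exp t)) / of_real (1 - exp t)) =
    (\<Sum>n\<le>sum_list ks. (-1) ^ q * of_int (polylog_coeff (rev ks) n) * mellin_kernel q s (real n + 1) t)"
proof -
  let ?w = "complex_of_real (1 - exp t)"
  have w: "?w \<noteq> 0" using assms(2) by simp
  have "polylog_value ks ?w / ?w = (\<Sum>n\<le>sum_list ks. of_int (polylog_coeff (rev ks) n) * (?w ^ q / (1 - ?w) ^ (n + Suc q)))"
    by (rule polylog_value_divide[OF assms(1) w])
  also have "\<dots> = (\<Sum>n\<le>sum_list ks. (-1) ^ q * of_int (polylog_coeff (rev ks) n) * of_real (exp (- ((real n + 1) * t)) * (1 - exp (- t)) ^ q))"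
  proof (rule sum.cong[OF refl])
    fix n
    define E where "E = exp (- ((real n + 1) * t))"
    have "exp t * exp (- t) = 1" by (simp add: exp_minus)
    hence "1 - exp t = - 1 * (exp t * (1 - exp (- t)))" by (simp add: right_diff_distrib)
    hence 1: "(1 - exp t) ^ q = (-1) ^ q * (exp t ^ q * (1 - exp (- t)) ^ q)" by (simp only: power_mult_distrib)
    have "exp ((real n + 1) * t) = exp t ^ Suc n"
      using exp_of_nat_mult[of "Suc n" t] by (simp only: of_nat_Suc add.commute)
    moreover have "exp t ^ (n + Suc q) = exp t ^ q * exp t ^ Suc n"
      by (simp only: power_add[symmetric] add_Suc_right add.commute)
    ultimately have 2: "exp t ^ (n + Suc q) = exp t ^ q * inverse E"
      by (simp only: E_def exp_minus inverse_inverse_eq)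
    have "E \<noteq> 0" by (simp add: E_def)
    hence "(1 - exp t) ^ q / exp t ^ (n + Suc q) = (-1) ^ q * (E * (1 - exp (- t)) ^ q)"
      unfolding 1 2 by (simp add: divide_inverse)
    hence "(1 - exp t) ^ q / exp t ^ (n + Suc q) = (-1) ^ q * (exp (- ((real n + 1) * t)) * (1 - exp (- t)) ^ q)"
      by (simp only: E_def)
    hence "complex_of_real ((1 - exp t) ^ q / exp t ^ (n + Suc q)) = of_real ((-1) ^ q * (exp (- ((real n + 1) * t)) * (1 - exp (- t)) ^ q))"
      by (simp only:)
    hence "?w ^ q / (1 - ?w) ^ (n + Suc q) = (-1) ^ q * of_real (exp (- ((real n + 1) * t)) * (1 - exp (- t)) ^ q)"
      by (simp del: power_Suc)
    thus "of_int (polylog_coeff (rev ks) n) * (?w ^ q / (1 - ?w) ^ (n + Suc q)) = (-1) ^ q * of_int (polylog_coeff (rev ks) n) * of_real (exp (- ((real n + 1) * t)) * (1 - exp (- t)) ^ q)"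
      by (simp only: mult_ac)
  qed
  finally have e: "polylog_value ks ?w / ?w = (\<Sum>n\<le>sum_list ks. (-1) ^ q * of_int (polylog_coeff (rev ks) n) * of_real (exp (- ((real n + 1) * t)) * (1 - exp (- t)) ^ q))" .
  show ?thesis unfolding e mellin_kernel_def
    by (simp only: sum_distrib_left mult_ac)
qed

section \<open>Identification of \<open>eta\<close> and of the poly-Bernoulli numbers\<close>

lemma eta_integral_eq:
  assumes ks: "length ks = Suc q" and s: "Re s > 1 - real (Suc q)"
  shows "rGamma s * (LBINT t:{0<..}. of_real t powr (s - 1) *
       (multi_polylog_rat (map (\<lambda>k. - int k) ks) (of_real (1 - exp t)) / of_real (1 - exp t))) = frakB_coeff s ks"
proof -
  have ks0: "ks \<noteq> []" using ks by auto
  let ?c = "\<lambda>n. (-1) ^ q * of_int (polylog_coeff (rev ks) n) :: complex"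
  \<comment> \<open>The half-plane in the definition of \<open>eta\<close> is
    \<open>Re s > - q\<close>, the one in which the undivided kernels are integrable.\<close>
  have i: "set_integrable lborel {0<..} (mellin_kernel q s (real n + 1))" for n
    using s by (intro set_integrable_mellin_kernel) auto
  have "(LBINT t:{0<..}. of_real t powr (s - 1) *
       (multi_polylog_rat (map (\<lambda>k. - int k) ks) (of_real (1 - exp t)) / of_real (1 - exp t)))
     = (LBINT t:{0<..}. \<Sum>n\<le>sum_list ks. ?c n * mellin_kernel q s (real n + 1) t)"
  proof (rule set_lebesgue_integral_cong)
    show "\<forall>t. t \<in> {0<..} \<longrightarrow> of_real t powr (s - 1) *
       (multi_polylog_rat (map (\<lambda>k. - int k) ks) (of_real (1 - exp t)) / of_real (1 - exp t))
       = (\<Sum>n\<le>sum_list ks. ?c n * mellin_kernel q s (real n + 1) t)"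
    proof (intro allI impI)
      fix t :: real assume "t \<in> {0<..}"
      hence t: "0 < t" by simp
      have "exp t \<noteq> 0" by simp
      hence "1 - exp t \<noteq> 1" by linarith
      hence "complex_of_real (1 - exp t) \<noteq> 1" by (metis of_real_eq_1_iff)
      from multi_polylog_rat_eq[OF ks0 this] show "of_real t powr (s - 1) *
       (multi_polylog_rat (map (\<lambda>k. - int k) ks) (of_real (1 - exp t)) / of_real (1 - exp t))
       = (\<Sum>n\<le>sum_list ks. ?c n * mellin_kernel q s (real n + 1) t)"
        using polylog_value_integrand[OF ks t, of s] by (simp only:)
    qed
  qed simp
  also have "\<dots> = (\<Sum>n\<le>sum_list ks. LBINT t:{0<..}. ?c n * mellin_kernel q s (real n + 1) t)"
    unfolding set_lebesgue_integral_def scaleR_sum_right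
    using set_integrable_mult_right[OF i] unfolding set_integrable_def
    by (intro Bochner_Integration.integral_sum) auto
  also have "rGamma s * \<dots> = (\<Sum>n\<le>sum_list ks. ?c n * (rGamma s * (LBINT t:{0<..}. mellin_kernel q s (real n + 1) t)))"
    by (simp only: set_integral_mult_right sum_distrib_left mult.left_commute)
  also have "\<dots> = (\<Sum>n\<le>sum_list ks. ?c n * mellin_value q s (real n + 1))"
    using s by (subst rGamma_LBINT_mellin_kernel) auto
  finally show ?thesis by (simp only: frakB_coeff_alt[OF ks])
qed

lemma eta_eq:
  assumes "ks \<noteq> []"
  shows "eta (map (\<lambda>k. - int k) ks) s = frakB_coeff s ks"
proof -
  obtain q where q: "length ks = Suc q" using assms by (cases ks) auto
  let ?H = "{s. Re s > 1 - real (Suc q)}"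
  have "eta (map (\<lambda>k. - int k) ks) = (\<lambda>s. frakB_coeff s ks)"
    unfolding eta_def length_map q
  proof (rule the_equality)
    fix f assume f: "f holomorphic_on UNIV \<and> (\<forall>s. Re s > 1 - real (Suc q) \<longrightarrow> f s = rGamma s *
       (LBINT t:{0<..}. of_real t powr (s - 1) * (multi_polylog_rat (map (\<lambda>k. - int k) ks) (of_real (1 - exp t)) / of_real (1 - exp t))))"
    have "f s = frakB_coeff s ks" for s
    proof (rule analytic_continuation_open[of ?H UNIV f "\<lambda>s. frakB_coeff s ks"])
      show "open ?H" by (rule open_halfspace_Re_gt)
      have "of_real 1 \<in> ?H" by simp
      thus "?H \<noteq> {}" by blast
      show "f z = frakB_coeff z ks" if "z \<in> ?H" for z
        using f that eta_integral_eq[OF q, of z] by simp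
    qed (use f frakB_coeff_holomorphic[OF q] in auto)
    thus "f = (\<lambda>s. frakB_coeff s ks)" by blast
  qed (use frakB_coeff_holomorphic[OF q] eta_integral_eq[OF q] in auto)
  thus ?thesis by simp
qed

text \<open>For \<open>x = 1 - exp (- t)\<close> one has \<open>1 - x = exp (- t)\<close>, so
  expanding \<open>x ^ q\<close> gives the exponentials \<open>exp ((n + q + 1 - a) t)\<close>.
  Their Taylor coefficients are the powers in \<open>frakB_coeff\<close> at \<open>s = - m\<close>,
  with the index \<open>a\<close> already in the right order.\<close>

lemma polylog_value_sums:
  assumes "length ks = Suc q" and x: "1 - exp (- t) \<noteq> 0"
  shows "(\<lambda>m. frakB_coeff (- of_nat m) ks * (t ^ m / fact m)) sums (polylog_value ks (1 - exp (- t)) / (1 - exp (- t)))"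
proof -
  let ?x = "1 - exp (- t)"
  let ?c = "\<lambda>n a. of_nat (n + Suc q) - of_nat a :: complex"
  let ?B = "sum_list ks"
  have "(\<lambda>m. (?c n a * t) ^ m / fact m) sums exp (?c n a * t)" for n a
    by (rule has_sum_imp_sums[OF has_sum_exp])
  hence "(\<lambda>m. \<Sum>a\<le>q. (-1) ^ a * of_nat (q choose a) * (\<Sum>n\<le>?B. of_int (polylog_coeff (rev ks) n) * ((?c n a * t) ^ m / fact m))) sums
     (\<Sum>a\<le>q. (-1) ^ a * of_nat (q choose a) * (\<Sum>n\<le>?B. of_int (polylog_coeff (rev ks) n) * exp (?c n a * t)))"
    by (intro sums_sum sums_mult)
  also have "(\<lambda>m. \<Sum>a\<le>q. (-1) ^ a * of_nat (q choose a) * (\<Sum>n\<le>?B. of_int (polylog_coeff (rev ks) n) * ((?c n a * t) ^ m / fact m)))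
     = (\<lambda>m. frakB_coeff (- of_nat m) ks * (t ^ m / fact m))"
  proof
    fix m
    have "1 / (?c n a powr (- of_nat m)) = ?c n a ^ m" if "a \<le> q" for n a
    proof -
      have "?c n a powr of_nat m = ?c n a ^ m" using shift_nonzero[OF that] by (intro powr_nat') blast
      thus ?thesis by (simp only: powr_minus inverse_eq_divide) simp
    qed
    thus "(\<Sum>a\<le>q. (-1) ^ a * of_nat (q choose a) * (\<Sum>n\<le>?B. of_int (polylog_coeff (rev ks) n) * ((?c n a * t) ^ m / fact m)))
      = frakB_coeff (- of_nat m) ks * (t ^ m / fact m)"
      unfolding frakB_coeff_def assms(1) diff_Suc_1 sum_distrib_right
      by (intro sum.cong refl) (simp add: sum_distrib_left sum_distrib_right power_mult_distrib mult_ac del: of_nat_add of_nat_Suc)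
  qed
  also have "(\<Sum>a\<le>q. (-1) ^ a * of_nat (q choose a) * (\<Sum>n\<le>?B. of_int (polylog_coeff (rev ks) n) * exp (?c n a * t)))
     = polylog_value ks ?x / ?x"
  proof -
    have "?x ^ q = (\<Sum>a\<le>q. of_nat (q choose a) * (- exp (- t)) ^ a * 1 ^ (q - a))"
      by (subst binomial_ring[symmetric]) simp
    hence xq: "?x ^ q = (\<Sum>a\<le>q. (-1) ^ a * of_nat (q choose a) * exp (- t) ^ a)"
      by (simp add: power_minus[of "exp (- t)"] mult_ac)
    have e: "exp (- t) ^ a / exp (- t) ^ (n + Suc q) = exp (?c n a * t)" for n a
    proof -
      have "?c n a * t = of_nat a * (- t) - of_nat (n + Suc q) * (- t)"
        by (simp only: left_diff_distrib mult_minus_right) simp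
      thus ?thesis by (simp only: exp_diff exp_of_nat_mult)
    qed
    have "polylog_value ks ?x / ?x = (\<Sum>n\<le>?B. of_int (polylog_coeff (rev ks) n) * (?x ^ q / exp (- t) ^ (n + Suc q)))"
    proof -
      have "1 - ?x = exp (- t)" by simp
      with polylog_value_divide[OF assms(1) x] show ?thesis by (simp only:)
    qed
    also have "\<dots> = (\<Sum>n\<le>?B. of_int (polylog_coeff (rev ks) n) * (\<Sum>a\<le>q. (-1) ^ a * of_nat (q choose a) * exp (?c n a * t)))"
      unfolding xq sum_divide_distrib by (simp only: e[symmetric] times_divide_eq_right)
    also have "\<dots> = (\<Sum>a\<le>q. (-1) ^ a * of_nat (q choose a) * (\<Sum>n\<le>?B. of_int (polylog_coeff (rev ks) n) * exp (?c n a * t)))"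
      unfolding sum_distrib_left by (subst sum.swap) (simp only: mult.left_commute)
    finally show ?thesis by simp
  qed
  finally show ?thesis .
qed

lemma multi_poly_bernoulli_eq:
  assumes "ks \<noteq> []"
  shows "multi_poly_bernoulli (map (\<lambda>k. - int k) ks) m = frakB_coeff (- of_nat m) ks"
proof -
  obtain q where q: "length ks = Suc q" using assms by (cases ks) auto
  let ?F = "\<lambda>t. multi_polylog (map (\<lambda>k. - int k) ks) (1 - exp (- t)) / (1 - exp (- t))"
  have ev: "\<forall>\<^sub>F t in at 0. (\<lambda>n. frakB_coeff (- of_nat n) ks * (t ^ n / fact n)) sums ?F t"
  proof -
    have "isCont (\<lambda>z::complex. 1 - exp (- z)) 0" by (intro continuous_intros)
    hence "((\<lambda>z::complex. 1 - exp (- z)) \<longlongrightarrow> 0) (at 0)" by (simp add: isCont_def)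
    from tendstoD[OF this, of 1] have "\<forall>\<^sub>F t in at (0::complex). norm (1 - exp (- t)) < 1"
      by (simp add: dist_norm)
    moreover have "\<forall>\<^sub>F t in at (0::complex). 1 - exp (- t) \<noteq> 0"
      unfolding eventually_at
    \<comment> \<open>Any radius up to \<open>2 * pi\<close> would do: the zeros of
      \<open>1 - exp (- t)\<close> are the integer multiples of
      \<open>2 * pi * \<i>\<close>.\<close>
    proof (intro exI[of _ 1] conjI ballI impI)
      fix t :: complex assume t: "t \<noteq> 0 \<and> dist t 0 < 1"
      have "\<bar>Im (- t) - Im 0\<bar> < 2 * pi"
        using abs_Im_le_cmod[of t] t pi_gt3 by (simp add: dist_norm)
      with exp_complex_eqI[of "- t" 0] t show "1 - exp (- t) \<noteq> 0" by auto
    qed simp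
    ultimately show ?thesis
    proof eventually_elim
      case (elim t)
      show ?case
        using polylog_value_sums[OF q elim(2)] unfolding multi_polylog_eq[OF assms elim(1)] .
    qed
  qed
  have "multi_poly_bernoulli (map (\<lambda>k. - int k) ks) = (\<lambda>n. frakB_coeff (- of_nat n) ks)"
    unfolding multi_poly_bernoulli_def
  proof (rule the_equality)
    fix b assume b: "\<forall>\<^sub>F t in at 0. (\<lambda>n. b n * (t ^ n / fact n)) sums ?F t"
    from eventually_conj[OF b ev] obtain d where d: "0 < d"
      "\<And>t. t \<noteq> 0 \<Longrightarrow> norm t < d \<Longrightarrow> (\<lambda>n. b n * (t ^ n / fact n)) sums ?F t \<and>
         (\<lambda>n. frakB_coeff (- of_nat n) ks * (t ^ n / fact n)) sums ?F t"
      unfolding eventually_at by (auto simp: dist_norm)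
    have "(b n - frakB_coeff (- of_nat n) ks) / fact n = 0" for n
    proof (rule powser_eq_0[OF d(1), of "\<lambda>n. (b n - frakB_coeff (- of_nat n) ks) / fact n"])
      fix t :: complex assume "t \<noteq> 0" "norm t < d"
      from sums_diff[OF conjunct1[OF d(2)[OF this]] conjunct2[OF d(2)[OF this]]]
      show "(\<lambda>n. (b n - frakB_coeff (- of_nat n) ks) / fact n * t ^ n) sums 0"
        by (simp add: left_diff_distrib diff_divide_distrib)
    qed
    thus "b = (\<lambda>n. frakB_coeff (- of_nat n) ks)" by (intro ext) simp
  qed (rule ev)
  thus ?thesis by simp
qed

theorem theorem4p7:
  fixes ks :: "nat list"
  assumes "ks \<noteq> []"
  shows "(\<forall>s::complex. eta (map (\<lambda>k. - int k) ks) s = frakB s ks) \<and>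
         (\<forall>m::nat. multi_poly_bernoulli (map (\<lambda>k. - int k) ks) m = frakB (- of_nat m) ks)"
  using eta_eq[OF assms] multi_poly_bernoulli_eq[OF assms] frakB_eq[OF assms] by simp

end
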